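(* Let $A$ be a finite alphabet, let $F_A$ be the free group on $A$, and let $\mathbf{H}$ be a pseudovariety of finite groups. Let $\overline{\mathbf{H}}$ be the class of all finite monoids all of whose subgroups belong to $\mathbf{H}$. Then $\overline{\mathbf{H}}$ is stable under all automorphisms of $F_A$; that is, for every automorphism $\varphi$ of $F_A$ and every finitely generated subgroup $K \leq F_A$, if $M(K) \in \overline{\mathbf{H}}$ then $M(K\varphi) \in \overline{\mathbf{H}}$.
   Context: Let $A^{-1}$ be the set of formal inverses of the letters of $A$ and $\widetilde A = A\cup A^{-1}$. Elements of $F_A$ are identified with reduced words in the free monoid $\widetilde A^*$. Maps are written on the right; $K\varphi$ is the image of $K$ under $\varphi$. Stallings automaton. Let $K=\langle u_1,\dots,u_k\rangle\leq F_A$ be finitely generated, with the $u_i$ nonempty reduced words in $\widetilde A^*$. Take a basepoint $q_0$, attach to it $k$ closed paths (petals) labeled $u_1,\dots,u_k$ with otherwise disjoint new vertices, and add for every edge $p\xrightarrow{a}q$ ($a\in\widetilde A$) its inverse edge $q\xrightarrow{a^{-1}}p$. Then successively identify ("fold") pairs of distinct edges $p\xrightarrow{a}q$, $p\xrightarrow{a}r$ ($a\in\widetilde A$), together with their inverse edges (so $q$ and $r$ are merged), until the automaton is deterministic. The result, with $q_0$ as unique initial and terminal state, is the Stallings automaton $\mathcal S(K)=(Q,A,\delta,q_0)$; up to isomorphism it depends only on $K$ and $A$ (for $K=1$ it is the single vertex $q_0$ with no edges). For $q\in Q$ and $u\in\widetilde A^*$, $q\cdot u$ denotes the vertex reached by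 reading $u$ from $q$, if this is possible (otherwise it is undefined), and $\delta_u$ is the partial transformation $q\mapsto q\cdot u$ of $Q$. The transition monoid is $M(K)=\{\delta_u \mid u\in\widetilde A^*\}$ under composition (left to right). A pseudovariety of finite groups is a class of finite groups closed under subgroups, homomorphic images and finite direct products. A subgroup of a monoid $M$ is a subsemigroup of $M$ that is a group (its identity element need not be the identity of $M$). *)

theory Defs
  imports "HOL-Algebra.Product_Groups" "HOL-Algebra.Generated_Groups"
begin

section \<open>The free group on an alphabet\<close>

text \<open>The letter \<open>a\<close> is encoded as \<open>(a, True)\<close>, its formal inverse as \<open>(a, False)\<close>.\<close>

type_synonym 'a letter = "'a \<times> bool"
type_synonym 'a word = "'a letter list"

definition letters :: "'a set \<Rightarrow> 'a letter set" where
  "letters A = A \<times> UNIV"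

definition inv_letter :: "'a letter \<Rightarrow> 'a letter" where
  "inv_letter x = (fst x, \<not> snd x)"

definition reduced :: "'a word \<Rightarrow> bool" where
  "reduced w \<longleftrightarrow> successively (\<lambda>x y. y \<noteq> inv_letter x) w"

text \<open>\<open>cancel_cons x w\<close> is the reduced form of \<open>x w\<close> whenever \<open>w\<close> is reduced, so
  \<open>reduce u\<close> is the reduced form of an arbitrary word \<open>u\<close>.\<close>

fun cancel_cons :: "'a letter \<Rightarrow> 'a word \<Rightarrow> 'a word" where
  "cancel_cons x [] = [x]"
| "cancel_cons x (y # w) = (if y = inv_letter x then w else x # y # w)"

definition reduce :: "'a word \<Rightarrow> 'a word" where
  "reduce u = foldr cancel_cons u []"

definition free_group :: "'a set \<Rightarrow> 'a word monoid" where
  "free_group A = \<lparr>carrier = {w \<in> lists (letters A). reduced w},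
                   mult = (\<lambda>u v. reduce (u @ v)),
                   one = []\<rparr>"

lemma inv_letter_inv_letter [simp]: "inv_letter (inv_letter x) = x"
  by (simp add: inv_letter_def)

lemma inv_letter_in_letters [simp]: "inv_letter x \<in> letters A \<longleftrightarrow> x \<in> letters A"
  by (cases x) (simp add: inv_letter_def letters_def)

lemma reduced_Nil [simp]: "reduced []"
  by (simp add: reduced_def)

lemma reduced_Cons:
  "reduced (x # w) \<longleftrightarrow> reduced w \<and> (w \<noteq> [] \<longrightarrow> hd w \<noteq> inv_letter x)"
  by (cases w) (auto simp: reduced_def)

lemma reduced_cancel_cons: "reduced w \<Longrightarrow> reduced (cancel_cons x w)"
  by (cases w) (auto simp: reduced_Cons)

lemma cancel_cons_inv_letter:
  assumes "reduced w"
  shows "cancel_cons x (cancel_cons (inv_letter x) w) = w"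
proof (cases w)
  case (Cons y v)
  then show ?thesis
    using assms by (cases v) (auto simp: reduced_Cons)
qed simp

lemma reduced_foldr: "reduced v \<Longrightarrow> reduced (foldr cancel_cons u v)"
  by (induction u) (auto simp: reduced_cancel_cons)

lemma letters_foldr:
  assumes "u \<in> lists (letters A)" "v \<in> lists (letters A)"
  shows "foldr cancel_cons u v \<in> lists (letters A)"
proof -
  have *: "cancel_cons x w \<in> lists (letters A)"
    if "x \<in> letters A" "w \<in> lists (letters A)" for x w
    using that by (cases w) auto
  show ?thesis
    using assms(1)
  proof (induction u)
    case (Cons x u)
    then show ?case
      using *[of x "foldr cancel_cons u v"] by simp
  qed (use assms(2) in simp)
qed

lemma foldr_cancel_cons:
  assumes "reduced w"
  shows "foldr cancel_cons (cancel_cons x v) w = cancel_cons x (foldr cancel_cons v w)"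
  using assms by (cases v) (auto simp: cancel_cons_inv_letter reduced_foldr)

lemma foldr_foldr_cancel_cons:
  assumes "reduced w"
  shows "foldr cancel_cons (foldr cancel_cons u v) w = foldr cancel_cons u (foldr cancel_cons v w)"
  by (induction u) (use assms in \<open>auto simp: foldr_cancel_cons\<close>)

lemma reduce_reduced: "reduced w \<Longrightarrow> reduce w = w"
proof (induction w)
  case (Cons x w)
  then show ?case
    by (cases w) (auto simp: reduce_def reduced_Cons)
qed (simp add: reduce_def)

lemma reduce_append: "reduced v \<Longrightarrow> reduce (u @ v) = foldr cancel_cons u v"
  using reduce_reduced[of v] by (simp add: reduce_def)

lemma group_free_group: "group (free_group A)"
proof (rule groupI)
  fix u v w
  assume "u \<in> carrier (free_group A)" "v \<in> carrier (free_group A)" "w \<in> carrier (free_group A)"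
  then show "u \<otimes>\<^bsub>free_group A\<^esub> v \<otimes>\<^bsub>free_group A\<^esub> w =
      u \<otimes>\<^bsub>free_group A\<^esub> (v \<otimes>\<^bsub>free_group A\<^esub> w)"
    by (simp add: free_group_def reduce_append reduced_foldr foldr_foldr_cancel_cons)
next
  fix u assume u: "u \<in> carrier (free_group A)"
  define v where "v = reduce (map inv_letter (rev u))"
  have red: "reduced v"
    by (simp add: v_def reduce_def reduced_foldr)
  have "map inv_letter (rev u) \<in> lists (letters A)"
    using u by (auto simp: free_group_def)
  then have letters: "v \<in> lists (letters A)"
    unfolding v_def reduce_def by (rule letters_foldr) simp
  have undo: "foldr cancel_cons (map inv_letter (rev u)) (foldr cancel_cons u w) = w"
    if "reduced w" for w
    using that
  proof (induction u arbitrary: w)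
    case (Cons x u)
    then show ?case
      using cancel_cons_inv_letter[of "foldr cancel_cons u w" "inv_letter x"]
      by (simp add: reduced_foldr)
  qed simp
  have "foldr cancel_cons v u = foldr cancel_cons (map inv_letter (rev u)) u"
    using u by (simp add: v_def reduce_def foldr_foldr_cancel_cons free_group_def)
  also have "\<dots> = []"
    using undo[of "[]"] u reduce_reduced[of u] by (simp add: reduce_def free_group_def)
  finally have "foldr cancel_cons v u = []" .
  then show "\<exists>v\<in>carrier (free_group A). v \<otimes>\<^bsub>free_group A\<^esub> u = \<one>\<^bsub>free_group A\<^esub>"
    using u red letters by (intro bexI[of _ v]) (auto simp: free_group_def reduce_append)
next
  fix u v assume "u \<in> carrier (free_group A)" "v \<in> carrier (free_group A)"
  then show "u \<otimes>\<^bsub>free_group A\<^esub> v \<in> carrier (free_group A)"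
    using letters_foldr[of u A v] by (simp add: free_group_def reduce_append reduced_foldr)
qed (auto simp: free_group_def reduce_reduced)

definition finitely_generated :: "('g, 'b) monoid_scheme \<Rightarrow> 'g set \<Rightarrow> bool" where
  "finitely_generated G K \<longleftrightarrow> (\<exists>S. finite S \<and> S \<subseteq> carrier G \<and> K = generate G S)"


section \<open>Stallings automata\<close>

text \<open>Edges form a set of triples, so two parallel edges with the same label are the same edge;
  only edges with distinct targets remain to be folded.\<close>

record ('q, 'a) automaton =
  states :: "'q set"
  edges :: "('q \<times> 'a letter \<times> 'q) set"
  base :: 'q

definition deterministic :: "('q, 'a) automaton \<Rightarrow> bool" where
  "deterministic S \<longleftrightarrow> (\<forall>p x q r. (p, x, q) \<in> edges S \<longrightarrow> (p, x, r) \<in> edges S \<longrightarrow> q = r)"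

text \<open>The petals are indexed by the positions in the list \<open>us\<close>. The \<open>j\<close>-th vertex along the
  \<open>i\<close>-th petal is the basepoint \<open>(0, 0)\<close> at both ends, and the new vertex \<open>(i, j)\<close>
  (with \<open>j > 0\<close>) otherwise.\<close>

definition petal_vertex :: "'a word list \<Rightarrow> nat \<Rightarrow> nat \<Rightarrow> nat \<times> nat" where
  "petal_vertex us i j = (if j = 0 \<or> j = length (us ! i) then (0, 0) else (i, j))"

definition flower :: "'a word list \<Rightarrow> (nat \<times> nat, 'a) automaton" where
  "flower us =
    \<lparr>states = insert (0, 0) {petal_vertex us i j | i j. i < length us \<and> j \<le> length (us ! i)},
     edges = {(petal_vertex us i j, us ! i ! j, petal_vertex us i (Suc j)) | i j.
                i < length us \<and> j < length (us ! i)}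
           \<union> {(petal_vertex us i (Suc j), inv_letter (us ! i ! j), petal_vertex us i j) | i j.
                i < length us \<and> j < length (us ! i)},
     base = (0, 0)\<rparr>"

definition rename_states :: "('q \<Rightarrow> 'q) \<Rightarrow> ('q, 'a) automaton \<Rightarrow> ('q, 'a) automaton" where
  "rename_states f S =
    \<lparr>states = f ` states S,
     edges = {(f p, x, f q) | p x q. (p, x, q) \<in> edges S},
     base = f (base S)\<rparr>"

text \<open>Merging \<open>r\<close> into \<open>q\<close> also identifies the edges inverse to the two folded ones.\<close>

inductive fold_step :: "('q, 'a) automaton \<Rightarrow> ('q, 'a) automaton \<Rightarrow> bool" where
  "(p, x, q) \<in> edges S \<Longrightarrow> (p, x, r) \<in> edges S \<Longrightarrow> q \<noteq> r \<Longrightarrow>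
    fold_step S (rename_states (id(r := q)) S)"

text \<open>Since \<open>\<S>(K)\<close> is only determined up to isomorphism, it is rendered as a relation: any
  automaton arising from any choice of generators of \<open>K\<close> and any complete sequence of foldings.\<close>

definition stallings_automaton ::
  "'a set \<Rightarrow> 'a word set \<Rightarrow> (nat \<times> nat, 'a) automaton \<Rightarrow> bool" where
  "stallings_automaton A K S \<longleftrightarrow>
    (\<exists>us. set us \<subseteq> carrier (free_group A) - {[]} \<and> K = generate (free_group A) (set us) \<and>
          fold_step\<^sup>*\<^sup>* (flower us) S \<and> deterministic S)"


text \<open>Folding terminates, so every finitely generated subgroup has a Stallings automaton.\<close>

lemma stallings_automaton_exists:
  assumes "finitely_generated (free_group A) K"
  obtains S where "stallings_automaton A K S"
proof -
  obtain T where T: "finite T" "T \<subseteq> carrier (free_group A)" "K = generate (free_group A) T"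
    using assms unfolding finitely_generated_def by blast
  interpret group "free_group A"
    by (rule group_free_group)
  have one: "\<one>\<^bsub>free_group A\<^esub> = []"
    by (simp add: free_group_def)
  obtain us where us: "set us = T - {[]}"
    using T(1) finite_list[of "T - {[]}"] by auto
  have "generate (free_group A) T \<subseteq> generate (free_group A) (T - {[]})"
  proof
    fix w assume "w \<in> generate (free_group A) T"
    then show "w \<in> generate (free_group A) (T - {[]})"
    proof induction
      case (incl h)
      then show ?case
        using generate.one[of "free_group A"] generate.incl[of h "T - {[]}"] one by (cases "h = []") auto
    next
      case (inv h)
      then show ?case
        using generate.one[of "free_group A" "T - {[]}"] generate.inv[of h "T - {[]}"] one inv_one
        by (cases "h = []") auto
    qed (auto intro: generate.intros)
  qed
  then have K: "K = generate (free_group A) (set us)"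
    using T(3) us mono_generate[of "T - {[]}" T] by auto
  have "\<exists>S'. fold_step\<^sup>*\<^sup>* S S' \<and> deterministic S'"
    if "finite (states S)" "\<forall>(p, x, q)\<in>edges S. p \<in> states S \<and> q \<in> states S"
    for S :: "(nat \<times> nat, 'a) automaton"
    using that
  proof (induction "card (states S)" arbitrary: S rule: less_induct)
    case less
    show ?case
    proof (cases "deterministic S")
      case False
      then obtain p x q r where e: "(p, x, q) \<in> edges S" "(p, x, r) \<in> edges S" "q \<noteq> r"
        unfolding deterministic_def by blast
      define S1 where "S1 = rename_states (id(r := q)) S"
      have step: "fold_step S S1"
        unfolding S1_def using e by (rule fold_step.intros)
      have qr: "q \<in> states S" "r \<in> states S"
        using less.prems e by auto
      have "states S1 \<subseteq> states S - {r}"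
        using qr e(3) by (auto simp: S1_def rename_states_def)
      then have "card (states S1) < card (states S)"
        using less.prems(1) qr(2) by (intro psubset_card_mono) auto
      moreover have "finite (states S1)"
        using less.prems(1) by (simp add: S1_def rename_states_def)
      moreover have "\<forall>(p, x, q)\<in>edges S1. p \<in> states S1 \<and> q \<in> states S1"
      proof clarify
        fix p' y q' assume "(p', y, q') \<in> edges S1"
        then obtain p0 q0 where "(p0, y, q0) \<in> edges S"
          and pq: "p' = (id(r := q)) p0" "q' = (id(r := q)) q0"
          unfolding S1_def rename_states_def by (simp del: fun_upd_apply) blast
        then have "p0 \<in> states S" "q0 \<in> states S"
          using less.prems(2) by auto
        then show "p' \<in> states S1 \<and> q' \<in> states S1"
          unfolding pq S1_def rename_states_def by (simp del: fun_upd_apply)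
      qed
      ultimately obtain S' where "fold_step\<^sup>*\<^sup>* S1 S'" "deterministic S'"
        using less.hyps by blast
      then show ?thesis
        using step by (meson converse_rtranclp_into_rtranclp)
    qed auto
  qed
  moreover have "finite (states (flower us))"
  proof -
    have "states (flower us) \<subseteq>
        insert (0, 0) (\<Union>i<length us. petal_vertex us i ` {..length (us ! i)})"
      by (auto simp: flower_def)
    then show ?thesis
      by (rule finite_subset) auto
  qed
  moreover have "\<forall>(p, x, q)\<in>edges (flower us). p \<in> states (flower us) \<and> q \<in> states (flower us)"
  proof -
    have st: "petal_vertex us i j \<in> states (flower us)"
      if "i < length us" "j \<le> length (us ! i)" for i j
      using that by (auto simp: flower_def)
    have "p \<in> states (flower us) \<and> q \<in> states (flower us)"
      if e: "(p, x, q) \<in> edges (flower us)" for p x q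
    proof -
      obtain i j where "i < length us" "j < length (us ! i)"
        "{p, q} = {petal_vertex us i j, petal_vertex us i (Suc j)}"
        using e unfolding flower_def by auto
      then show ?thesis
        using st[of i j] st[of i "Suc j"] by (auto simp: doubleton_eq_iff)
    qed
    then show ?thesis
      by blast
  qed
  ultimately obtain S where "fold_step\<^sup>*\<^sup>* (flower us) S" "deterministic S"
    by blast
  then have "stallings_automaton A K S"
    unfolding stallings_automaton_def using us T(2) K by (intro exI[of _ us]) auto
  then show thesis
    by (rule that)
qed


section \<open>The transition monoid\<close>

text \<open>Meaningful for deterministic automata only.\<close>

definition next_state :: "('q, 'a) automaton \<Rightarrow> 'a letter \<Rightarrow> 'q \<rightharpoonup> 'q" where
  "next_state S x q =
    (if \<exists>r. (q, x, r) \<in> edges S then Some (THE r. (q, x, r) \<in> edges S) else None)"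

text \<open>Maps act on the right, so the product of \<open>f\<close> and \<open>g\<close> is \<open>g \<circ>\<^sub>m f\<close>.\<close>

primrec transition :: "('q, 'a) automaton \<Rightarrow> 'a word \<Rightarrow> 'q \<rightharpoonup> 'q" where
  "transition S [] = Some |` states S"
| "transition S (x # u) = transition S u \<circ>\<^sub>m next_state S x"

definition transition_monoid :: "'a set \<Rightarrow> ('q, 'a) automaton \<Rightarrow> ('q \<rightharpoonup> 'q) monoid" where
  "transition_monoid A S = \<lparr>carrier = transition S ` lists (letters A),
                            mult = (\<lambda>f g. g \<circ>\<^sub>m f),
                            one = transition S []\<rparr>"


section \<open>Pseudovarieties\<close>

text \<open>Every finite group is isomorphic to one with carrier in \<open>nat\<close>, so a class of finite groups
  closed under isomorphism is given by its members over \<open>nat\<close>; membership of a group over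
  another type is membership of an isomorphic copy. Closure under isomorphism is a special case
  of closure under homomorphic images.\<close>

definition pseudovariety :: "nat monoid set \<Rightarrow> bool" where
  "pseudovariety H \<longleftrightarrow>
    (\<forall>G\<in>H. group G \<and> finite (carrier G)) \<and>
    (\<forall>G\<in>H. \<forall>U. subgroup U G \<longrightarrow> G\<lparr>carrier := U\<rparr> \<in> H) \<and>
    (\<forall>G\<in>H. \<forall>N. group N \<longrightarrow> epi G N \<noteq> {} \<longrightarrow> N \<in> H) \<and>
    (\<forall>(I :: nat set) G. finite I \<longrightarrow> (\<forall>i\<in>I. G i \<in> H) \<longrightarrow>
       (\<forall>P. group P \<longrightarrow> P \<cong> product_group I G \<longrightarrow> P \<in> H))"

definition in_class :: "'m monoid \<Rightarrow> nat monoid set \<Rightarrow> bool" where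
  "in_class G H \<longleftrightarrow> (\<exists>N\<in>H. G \<cong> N)"

text \<open>The identity \<open>e\<close> of a subgroup \<open>U\<close> of \<open>M\<close> need not be the identity of \<open>M\<close>.\<close>

definition overline_class :: "nat monoid set \<Rightarrow> 'm monoid set" where
  "overline_class H = {M. monoid M \<and> finite (carrier M) \<and>
    (\<forall>U e. U \<subseteq> carrier M \<longrightarrow> group (M\<lparr>carrier := U, one := e\<rparr>) \<longrightarrow>
       in_class (M\<lparr>carrier := U, one := e\<rparr>) H)}"

end

theory Submission
  imports Defs "HOL-Algebra.Multiplicative_Group"
begin

text \<open>The vertices of the Stallings automaton of \<open>K\<close> are right cosets of \<open>K\<close>, and a subgroup of its
  transition monoid is the permutation group that a subgroup \<open>L\<close> of the free group induces on
  a finite \<open>L\<close>-invariant set \<open>Y\<close> of cosets. Such pairs \<open>(L, Y)\<close> are preserved by automorphisms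
  of the free group, so it suffices that, conversely, the group induced by \<open>L\<close> on any such \<open>Y\<close>
  is an image of a subgroup of the transition monoid. If \<open>L\<close> is nontrivial, a conjugate of it contains a cyclically
  reduced \<open>e\<close>; choose it, among all conjugates of \<open>L\<close>, such that the set \<open>Z\<close> of cosets with
  finite \<open>e\<close>-orbit is as small as possible. All these cosets are vertices of the automaton, \<open>Z\<close>
  contains \<open>Y\<close>, and minimality makes \<open>Z\<close> invariant under \<open>L\<close>. For large \<open>N\<close> with \<open>e\<^sup>N\<close> trivial
  on \<open>Z\<close>, the reduced form of \<open>e\<^sup>N g\<close> starts with a high power of \<open>e\<close>, hence it can be read exactly
  from the vertices in \<open>Z\<close> and acts there like \<open>g\<close>. So the group induced by \<open>L\<close> on \<open>Z\<close>, which maps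
  onto the one induced on \<open>Y\<close>, is a subgroup of the transition monoid.\<close>

section \<open>Words\<close>

definition winv :: "'a word \<Rightarrow> 'a word" where
  "winv w = rev (map inv_letter w)"

lemma winv_Nil [simp]: "winv [] = []"
  and winv_Cons [simp]: "winv (x # w) = winv w @ [inv_letter x]"
  and winv_append [simp]: "winv (u @ v) = winv v @ winv u"
  and length_winv [simp]: "length (winv w) = length w"
  and winv_eq_Nil [simp]: "winv w = [] \<longleftrightarrow> w = []"
  by (simp_all add: winv_def)

lemma winv_winv [simp]: "winv (winv w) = w"
  by (induction w) auto

lemma inv_letter_neq [simp]: "inv_letter x \<noteq> x" "x \<noteq> inv_letter x"
  by (cases x; auto simp: inv_letter_def)+

lemma inv_letter_eq_iff: "inv_letter x = y \<longleftrightarrow> x = inv_letter y"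
  by (metis inv_letter_inv_letter)

lemma winv_in_lists [simp]: "winv w \<in> lists (letters A) \<longleftrightarrow> w \<in> lists (letters A)"
  by (induction w) auto

lemma set_winv [simp]: "set (winv w) = inv_letter ` set w"
  by (simp add: winv_def)

lemma hd_winv: "w \<noteq> [] \<Longrightarrow> hd (winv w) = inv_letter (last w)"
  by (simp add: winv_def hd_rev last_map)

lemma last_winv: "w \<noteq> [] \<Longrightarrow> last (winv w) = inv_letter (hd w)"
  by (simp add: winv_def last_rev hd_map)

lemma reduced_append:
  "reduced (u @ v) \<longleftrightarrow>
    reduced u \<and> reduced v \<and> (u \<noteq> [] \<longrightarrow> v \<noteq> [] \<longrightarrow> hd v \<noteq> inv_letter (last u))"
  by (auto simp: reduced_def successively_append_iff)

lemma reduced_winv [simp]: "reduced (winv w) \<longleftrightarrow> reduced w"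
proof -
  have "reduced (winv w)" if "reduced w" for w :: "'a word"
    using that
  proof (induction w)
    case (Cons x w)
    then show ?case
      by (cases "w = []") (auto simp: reduced_Cons reduced_append last_winv inv_letter_eq_iff)
  qed simp
  from this[of w] this[of "winv w"] show ?thesis
    by auto
qed

lemma reduced_reduce [simp]: "reduced (reduce w)"
  by (simp add: reduce_def reduced_foldr)

lemma reduce_Nil [simp]: "reduce [] = []"
  by (simp add: reduce_def)

lemma reduce_Cons: "reduce (x # w) = cancel_cons x (reduce w)"
  by (simp add: reduce_def)

section \<open>Cancellation in products of reduced words\<close>

lemma reduce_append_reduce: "reduce (reduce u @ reduce v) = reduce (u @ v)"
proof -
  have "reduce (reduce u @ reduce v) = foldr cancel_cons (reduce u) (reduce v)"
    by (simp add: reduce_append)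
  also have "\<dots> = foldr cancel_cons u (reduce v)"
    unfolding reduce_def[of u] by (subst foldr_foldr_cancel_cons) auto
  also have "\<dots> = reduce (u @ v)"
    by (simp add: reduce_def)
  finally show ?thesis .
qed

lemma reduce_in_lists: "w \<in> lists (letters A) \<Longrightarrow> reduce w \<in> lists (letters A)"
  unfolding reduce_def by (rule letters_foldr) auto

text \<open>Induction on \<open>u\<close>. A new first letter \<open>x\<close> is put in front of
  the reduced product \<open>p @ t\<close> of the rest. If \<open>p\<close> is nonempty,
  \<open>x\<close> meets the letter following it in a reduced word and stays; only for empty
  \<open>p\<close> can it cancel, and then it joins the cancelled part \<open>s\<close>.\<close>

lemma reduce_append_cancel:
  assumes "reduced u" "reduced v"
  obtains p s t where "u = p @ s" "v = winv s @ t" "reduce (u @ v) = p @ t"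
proof -
  have "\<exists>p s t. u = p @ s \<and> v = winv s @ t \<and> reduce (u @ v) = p @ t"
    using assms(1)
  proof (induction u)
    case Nil
    show ?case
      by (rule exI[of _ "[]"], rule exI[of _ "[]"], rule exI[of _ v])
        (simp add: assms(2) reduce_reduced)
  next
    case (Cons x u)
    have "reduced u"
      using Cons.prems by (simp add: reduced_Cons)
    from Cons.IH[OF this]
    obtain p s t where *: "u = p @ s" "v = winv s @ t" "reduce (u @ v) = p @ t"
      by (elim exE conjE)
    have red: "reduce ((x # u) @ v) = cancel_cons x (p @ t)"
      using * by (simp add: reduce_Cons)
    consider y p' where "p = y # p'" | t' where "p = []" "t = inv_letter x # t'"
      | "p = []" "\<nexists>t'. t = inv_letter x # t'"
      by (cases p) auto
    then show ?case
    proof cases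
      case 1
      then have "reduce ((x # u) @ v) = (x # p) @ t"
        using Cons.prems red * by (auto simp: reduced_Cons)
      then show ?thesis
        using * by (metis append_Cons)
    next
      case 2
      then have "reduce ((x # u) @ v) = [] @ t'" "x # u = [] @ (x # s)" "v = winv (x # s) @ t'"
        using red * by auto
      then show ?thesis
        by metis
    next
      case 3
      then have "reduce ((x # u) @ v) = [x] @ t" "x # u = [x] @ s"
        using red * by (cases t; auto)+
      then show ?thesis
        using *(2) by metis
    qed
  qed
  then show thesis
    using that by blast
qed

text \<open>The cancelled part is no longer than \<open>v\<close>, hence lies within
  \<open>u'\<close> and leaves \<open>u\<close> intact.\<close>

lemma reduce_append_prefix:
  assumes "reduced (u @ u')" "reduced v" "length v \<le> length u'"
  obtains t where "reduce ((u @ u') @ v) = u @ t"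
proof -
  obtain p s t where *: "u @ u' = p @ s" "v = winv s @ t" "reduce ((u @ u') @ v) = p @ t"
    using reduce_append_cancel[OF assms(1,2)] by blast
  have "length u + length u' = length p + length s"
    using arg_cong[OF *(1), of length] by (simp only: length_append)
  then have "length u \<le> length p"
    using assms(3) *(2) by simp
  then obtain q where "p = u @ q"
    using *(1) by (metis append_eq_append_conv_if append_take_drop_id)
  then show thesis
    using * that by auto
qed

lemma reduce_append_suffix:
  assumes "reduced v" "reduced (u' @ u)" "length v \<le> length u'"
  obtains t where "reduce (v @ (u' @ u)) = t @ u"
proof -
  obtain p s t where *: "v = p @ s" "u' @ u = winv s @ t" "reduce (v @ (u' @ u)) = p @ t"
    using reduce_append_cancel[OF assms(1,2)] by blast
  then have "length (winv s) \<le> length u'"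
    using assms(3) by auto
  then obtain q where "t = q @ u"
    using *(2) by (metis append_eq_append_conv_if append_take_drop_id append_assoc append_same_eq
      append_eq_append_conv length_append)
  then show thesis
    using * that[of "p @ q"] by auto
qed

section \<open>Cyclically reduced words\<close>

text \<open>The condition on the two ends makes every power reduced as it stands; the empty word is
  excluded so that powers become arbitrarily long.\<close>

definition cyc_reduced :: "'a word \<Rightarrow> bool" where
  "cyc_reduced w \<longleftrightarrow> reduced w \<and> w \<noteq> [] \<and> hd w \<noteq> inv_letter (last w)"

definition wpow :: "'a word \<Rightarrow> nat \<Rightarrow> 'a word" where
  "wpow w n = concat (replicate n w)"

lemma wpow_0 [simp]: "wpow w 0 = []"
  and wpow_Suc [simp]: "wpow w (Suc n) = w @ wpow w n"
  by (simp_all add: wpow_def)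

lemma wpow_add: "wpow w (m + n) = wpow w m @ wpow w n"
  by (induction m) auto

lemma wpow_Suc_right: "wpow w (Suc n) = wpow w n @ w"
  using wpow_add[of w n 1] by simp

lemma length_wpow [simp]: "length (wpow w n) = n * length w"
  by (induction n) auto

lemma length_wpow_ge: "w \<noteq> [] \<Longrightarrow> n \<le> length (wpow w n)"
  by (cases w) auto

lemma hd_wpow: "w \<noteq> [] \<Longrightarrow> n > 0 \<Longrightarrow> hd (wpow w n) = hd w"
  by (cases n) auto

lemma wpow_eq_Nil [simp]: "wpow w n = [] \<longleftrightarrow> w = [] \<or> n = 0"
  by (cases n) (auto simp: wpow_def)

lemma reduced_wpow: "cyc_reduced w \<Longrightarrow> reduced (wpow w n)"
proof (induction n)
  case (Suc n)
  then show ?case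
    by (cases n) (auto simp: reduced_append cyc_reduced_def)
qed simp

lemma cyc_reduced_winv [simp]: "cyc_reduced (winv w) \<longleftrightarrow> cyc_reduced w"
  by (auto simp: cyc_reduced_def hd_winv last_winv inv_letter_eq_iff)

lemma nth_wpow: "i < n * length w \<Longrightarrow> wpow w n ! i = w ! (i mod length w)"
proof (induction n arbitrary: i)
  case (Suc n)
  then show ?case
    by (cases "i < length w") (auto simp: nth_append le_mod_geq)
qed simp

text \<open>Otherwise the bi-infinite word with period \<open>w\<close> would be mapped to itself by a reflection of
  its indices combined with letter inversion. The centre of the reflection would be a letter equal
  to its inverse or a pair of adjacent mutually inverse letters.\<close>

lemma winv_not_factor_wpow:
  assumes "cyc_reduced w"
  shows "wpow w n \<noteq> p @ winv w @ q"
proof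
  assume eq: "wpow w n = p @ winv w @ q"
  define l k where "l = length w" and "k = length p"
  have l: "l > 0"
    using assms by (simp add: l_def cyc_reduced_def)
  define c where "c = (\<lambda>i. w ! (i mod l))"
  have len: "n * l = k + l + length q"
    using arg_cong[OF eq, of length] by (simp add: l_def k_def)
  have refl0: "c (k + j) = inv_letter (c (l - 1 - j))" if "j < l" for j
  proof -
    have "c (k + j) = wpow w n ! (k + j)"
      using that len by (simp add: nth_wpow c_def l_def)
    also have "\<dots> = winv w ! j"
      using that by (simp add: eq nth_append k_def l_def)
    also have "\<dots> = inv_letter (w ! (l - 1 - j))"
      using that by (simp add: winv_def rev_nth l_def)
    finally show ?thesis
      using that by (simp add: c_def)
  qed
  have per: "c (i + l * m) = c i" for i m
    by (simp add: c_def)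
  \<comment> \<open>The occurrence of \<open>winv w\<close> at offset \<open>k\<close> covers a
    single period of indices. Since \<open>c\<close> has period \<open>l\<close>, shifting indices
    by multiples of \<open>l\<close> extends the reflection to all such pairs.\<close>
  have refl: "c i = inv_letter (c j)" if ij: "i + j = k + l - 1 + l * m" for i j m
  proof -
    have "\<exists>j'<l. j' = j mod l"
      using l by simp
    then obtain j' where j': "j' < l" "j' = j mod l" by blast
    define b where "b = j div l"
    have j: "j = j' + l * b"
      by (simp add: j' b_def)
    have "i + l * b = k + (l - 1 - j') + l * m"
      using ij j j'(1) l by linarith
    then have "c i = c (k + (l - 1 - j'))"
      using per[of i b] per[of "k + (l - 1 - j')" m] by simp
    also have "\<dots> = inv_letter (c j')"
      using refl0[of "l - 1 - j'"] j'(1) by simp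
    also have "c j' = c j"
      using per[of j' b] j by simp
    finally show ?thesis .
  qed
  have step: "c (Suc i) \<noteq> inv_letter (c i)" for i
  proof (cases "Suc (i mod l) = l")
    case True
    then have "Suc i mod l = 0"
      by (simp add: mod_Suc)
    moreover have "i mod l = l - 1"
      using True by simp
    moreover have "w \<noteq> []"
      using l by (simp add: l_def)
    ultimately have "c (Suc i) = hd w" "c i = last w"
      by (simp_all add: c_def hd_conv_nth last_conv_nth l_def)
    then show ?thesis
      using assms by (simp add: cyc_reduced_def)
  next
    case False
    then have s: "Suc i mod l = Suc (i mod l)" "Suc (i mod l) < l"
      using l by (auto simp: mod_Suc Suc_lessI)
    have "reduced w"
      using assms by (simp add: cyc_reduced_def)
    then have "w ! Suc (i mod l) \<noteq> inv_letter (w ! (i mod l))"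
      using s unfolding reduced_def l_def by (simp add: successively_conv_nth)
    then show ?thesis
      using s by (simp add: c_def)
  qed
  show False
  proof (cases "even (k + l - 1)")
    case True
    then obtain i where "k + l - 1 = i + i"
      by (metis evenE mult_2)
    then show False
      using refl[of i i 0] by simp
  next
    case False
    then obtain i where "k + l - 1 = Suc i + i"
      by (metis oddE mult_2 add_Suc Suc_eq_plus1)
    then show False
      using refl[of "Suc i" i 0] step[of i] by simp
  qed
qed

text \<open>Mutually inverse end letters are peeled off. A two-letter word with such ends is not
  reduced, so peeling never reaches the empty word.\<close>

lemma cyc_reduced_conjugate:
  assumes "reduced w" "w \<noteq> []"
  obtains s c where "w = s @ c @ winv s" "cyc_reduced c"
proof -
  have "\<exists>s c. w = s @ c @ winv s \<and> cyc_reduced c"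
    using assms
  proof (induction w rule: length_induct)
    case (1 w)
    show ?case
    proof (cases "cyc_reduced w")
      case True
      then show ?thesis
        by (intro exI[of _ "[]"] exI[of _ w]) auto
    next
      case False
      then have hl: "hd w = inv_letter (last w)"
        using 1 by (auto simp: cyc_reduced_def)
      obtain x v where w: "w = x # v"
        using 1 by (cases w) auto
      with hl have "v \<noteq> []"
        by auto
      then obtain u where v: "v = u @ [inv_letter x]"
        using hl w by (metis append_butlast_last_id inv_letter_inv_letter last_ConsR list.sel(1))
      have "u \<noteq> []" "reduced u"
        using 1(2) by (auto simp: w v reduced_Cons reduced_append)
      then obtain s c where "u = s @ c @ winv s" "cyc_reduced c"
        using 1(1) w v by (metis length_append length_Cons less_SucI less_add_Suc1 add_Suc_right add.commute add_0 list.size(3,4))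
      then show ?thesis
        using w v by (intro exI[of _ "x # s"] exI[of _ c]) auto
    qed
  qed
  then show thesis
    using that by blast
qed

section \<open>The free group\<close>

locale alphabet =
  fixes A :: "'a set"
begin

abbreviation F :: "'a word monoid" where
  "F \<equiv> free_group A"

sublocale group F
  by (rule group_free_group)

lemma carrier_F: "w \<in> carrier F \<longleftrightarrow> w \<in> lists (letters A) \<and> reduced w"
  by (simp add: free_group_def)

lemma mult_F: "u \<otimes>\<^bsub>F\<^esub> v = reduce (u @ v)"
  by (simp add: free_group_def)

lemma one_F: "\<one>\<^bsub>F\<^esub> = []"
  by (simp add: free_group_def)

lemma reduce_in_F: "w \<in> lists (letters A) \<Longrightarrow> reduce w \<in> carrier F"
  by (simp add: carrier_F reduce_in_lists del: in_lists_conv_set)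

lemma mult_reduce: "reduce u \<otimes>\<^bsub>F\<^esub> reduce v = reduce (u @ v)"
  by (simp add: mult_F reduce_append_reduce)

lemma reduce_winv_append: "reduce (winv w @ w) = []"
proof (induction w)
  case (Cons x w)
  have "reduce (winv (x # w) @ x # w) = reduce (winv w @ (inv_letter x # x # w))"
    by simp
  also have "\<dots> = reduce (reduce (winv w) @ reduce (inv_letter x # x # w))"
    by (simp only: reduce_append_reduce)
  also have "reduce (inv_letter x # x # w) = reduce w"
    using cancel_cons_inv_letter[of "reduce w" "inv_letter x"] by (simp add: reduce_Cons)
  finally show ?case
    using Cons by (simp add: reduce_append_reduce)
qed simp

lemma winv_in_F: "w \<in> carrier F \<Longrightarrow> winv w \<in> carrier F"
  by (simp add: carrier_F del: in_lists_conv_set)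

lemma inv_F: "w \<in> carrier F \<Longrightarrow> inv\<^bsub>F\<^esub> w = winv w"
  by (rule inv_equality) (auto simp: mult_F one_F reduce_winv_append winv_in_F)

lemma inv_reduce: "w \<in> lists (letters A) \<Longrightarrow> inv\<^bsub>F\<^esub> (reduce w) = reduce (winv w)"
  by (rule inv_equality)
    (simp_all add: mult_reduce one_F reduce_winv_append reduce_in_F del: in_lists_conv_set)

lemma pow_F: "cyc_reduced w \<Longrightarrow> w \<in> carrier F \<Longrightarrow> w [^]\<^bsub>F\<^esub> n = wpow w n"
proof (induction n)
  case (Suc n)
  then have "w [^]\<^bsub>F\<^esub> Suc n = reduce (wpow w n @ w)"
    by (simp add: mult_F)
  also have "\<dots> = wpow w (Suc n)"
    by (metis Suc.prems(1) reduced_wpow reduce_reduced wpow_Suc_right)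
  finally show ?case .
qed (simp add: one_F)

end

section \<open>Stallings automata and cosets\<close>

text \<open>The empty path asks for a vertex, in agreement with \<open>transition S []\<close>,
  which is the identity on the states only.\<close>

primrec path :: "('q, 'a) automaton \<Rightarrow> 'q \<Rightarrow> 'a word \<Rightarrow> 'q \<Rightarrow> bool" where
  "path S p [] q \<longleftrightarrow> p = q \<and> p \<in> states S"
| "path S p (x # w) q \<longleftrightarrow> (\<exists>r. (p, x, r) \<in> edges S \<and> path S r w q)"

lemma edges_rename_states:
  "(p, x, q) \<in> edges (rename_states f S) \<longleftrightarrow>
    (\<exists>p' q'. (p', x, q') \<in> edges S \<and> p = f p' \<and> q = f q')"
  by (cases x) (auto simp: rename_states_def)

lemma states_rename_states: "states (rename_states f S) = f ` states S"
  and base_rename_states: "base (rename_states f S) = f (base S)"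
  by (simp_all add: rename_states_def)

lemma path_rename_states: "path S p w q \<Longrightarrow> path (rename_states f S) (f p) w (f q)"
  by (induction w arbitrary: p) (auto simp: edges_rename_states states_rename_states)

text \<open>The map \<open>co\<close> to right cosets of the generated subgroup is constant under foldings, since the
  two vertices being merged already lie in the same coset.\<close>

locale coset_graph = alphabet A
  for A :: "'a set" +
  fixes T :: "'a word set" and S :: "('q, 'a) automaton" and co :: "'q \<Rightarrow> 'a word set"
  assumes gens: "T \<subseteq> carrier F"
    and finite_states: "finite (states S)"
    and base_state: "base S \<in> states S"
    and edges_states: "(p, x, q) \<in> edges S \<Longrightarrow> p \<in> states S \<and> x \<in> letters A \<and> q \<in> states S"
    and edges_inv: "(p, x, q) \<in> edges S \<Longrightarrow> (q, inv_letter x, p) \<in> edges S"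
    and reachable: "q \<in> states S \<Longrightarrow> \<exists>w. path S (base S) w q"
    and gens_loop: "u \<in> T \<Longrightarrow> path S (base S) u (base S)"
    and co_base: "co (base S) = generate F T"
    and co_edge: "(p, x, q) \<in> edges S \<Longrightarrow> co q = co p #>\<^bsub>F\<^esub> [x]"
begin

abbreviation K :: "'a word set" where
  "K \<equiv> generate F T"

lemma subgroup_K: "subgroup K F"
  by (rule generate_is_subgroup[OF gens])

lemma K_subset: "K \<subseteq> carrier F"
  by (rule subgroup.subset[OF subgroup_K])

lemma path_states: "path S p w q \<Longrightarrow> p \<in> states S \<and> q \<in> states S"
  by (induction w arbitrary: p) (auto dest: edges_states)

lemma path_letters: "path S p w q \<Longrightarrow> w \<in> lists (letters A)"
  by (induction w arbitrary: p) (auto dest: edges_states)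

lemma path_append: "path S p (u @ v) q \<longleftrightarrow> (\<exists>r. path S p u r \<and> path S r v q)"
  by (induction u arbitrary: p) (auto dest: path_states)

lemma path_winv: "path S p w q \<Longrightarrow> path S q (winv w) p"
proof (induction w arbitrary: p)
  case (Cons x w)
  then obtain r where r: "(p, x, r) \<in> edges S" "path S r w q"
    by auto
  then have "path S r [inv_letter x] p"
    using edges_inv edges_states by auto
  then show ?case
    using Cons.IH[OF r(2)] by (auto simp: path_append)
qed simp

lemma fold_coset_graph:
  assumes "fold_step S S1"
  shows "coset_graph A T S1 co"
  using assms
proof cases
  case (1 p x q r)
  define f where "f = id(r := q)"
  have S1: "S1 = rename_states f S"
    using 1 by (simp add: f_def)
  have "co q = co r"
    using 1 co_edge by metis
  then have co_f: "co (f s) = co s" for s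
    by (simp add: f_def)
  show ?thesis
  proof
    fix u assume "u \<in> states S1"
    then show "\<exists>w. path S1 (base S1) w u"
      using reachable path_rename_states by (fastforce simp: S1 states_rename_states base_rename_states)
  next
    fix u assume "u \<in> T"
    then show "path S1 (base S1) u (base S1)"
      unfolding S1 base_rename_states by (intro path_rename_states gens_loop)
  next
    fix p x q assume "(p, x, q) \<in> edges S1"
    then obtain p' q' where e: "(p', x, q') \<in> edges S" "p = f p'" "q = f q'"
      unfolding S1 edges_rename_states by blast
    then show "p \<in> states S1 \<and> x \<in> letters A \<and> q \<in> states S1"
      using edges_states by (simp add: S1 states_rename_states)
    show "(q, inv_letter x, p) \<in> edges S1"
      using e edges_inv unfolding S1 edges_rename_states by blast
    show "co q = co p #>\<^bsub>F\<^esub> [x]"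
      using e co_edge co_f by simp
  qed (use gens finite_states base_state co_base co_f in
      \<open>simp_all add: S1 states_rename_states base_rename_states\<close>)
qed

end

text \<open>The vertex reached after \<open>j\<close> letters of a petal gets the coset of that
  prefix. At the end of the petal this agrees with the coset of the basepoint because the whole
  label is a generator.\<close>

lemma (in alphabet) flower_coset_graph:
  assumes us: "set us \<subseteq> carrier F"
  shows "coset_graph A (set us) (flower us)
    (\<lambda>(i, j). if j = 0 then generate F (set us)
      else generate F (set us) #>\<^bsub>F\<^esub> reduce (take j (us ! i)))" (is "coset_graph A _ ?S ?co")
proof -
  define K where "K = generate F (set us)"
  have K: "subgroup K F"
    unfolding K_def by (rule generate_is_subgroup[OF us])
  have letters: "us ! i \<in> lists (letters A)" "reduced (us ! i)" if "i < length us" for i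
    using subsetD[OF us nth_mem[OF that]] unfolding carrier_F by blast+
  have take_F: "reduce (take j (us ! i)) \<in> carrier F" if "i < length us" for i j
    using letters[OF that] by (intro reduce_in_F) (auto dest: in_set_takeD)
  have co_petal: "?co (petal_vertex us i j) = K #>\<^bsub>F\<^esub> reduce (take j (us ! i))"
    if "i < length us" "j \<le> length (us ! i)" for i j
  proof -
    have "K #>\<^bsub>F\<^esub> (us ! i) = K"
      using that us K by (intro coset_join2) (auto simp: K_def intro: generate.incl)
    moreover have "K #>\<^bsub>F\<^esub> [] = K"
      using coset_mult_one[OF subgroup.subset[OF K]] by (simp add: one_F)
    ultimately show ?thesis
      using that letters by (auto simp: petal_vertex_def K_def reduce_reduced)
  qed
  have petal: "petal_vertex us i j \<in> states ?S" if "i < length us" "j \<le> length (us ! i)" for i j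
    using that by (auto simp: flower_def)
  have edge: "(petal_vertex us i j, us ! i ! j, petal_vertex us i (Suc j)) \<in> edges ?S"
    if "i < length us" "j < length (us ! i)" for i j
    using that by (auto simp: flower_def)
  have step: "p \<in> states ?S \<and> x \<in> letters A \<and> q \<in> states ?S
      \<and> (q, inv_letter x, p) \<in> edges ?S \<and> ?co q = ?co p #>\<^bsub>F\<^esub> [x]"
    if e: "(p, x, q) \<in> edges ?S" for p x q
  proof -
    obtain i j where ij: "i < length us" "j < length (us ! i)" and
      "p = petal_vertex us i j \<and> x = us ! i ! j \<and> q = petal_vertex us i (Suc j) \<or>
       p = petal_vertex us i (Suc j) \<and> x = inv_letter (us ! i ! j) \<and> q = petal_vertex us i j"
      using e by (auto simp: flower_def)
    moreover have y: "us ! i ! j \<in> letters A"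
      using letters[OF ij(1)] ij(2) by auto
    moreover have "(petal_vertex us i (Suc j), inv_letter (us ! i ! j), petal_vertex us i j) \<in> edges ?S"
      using ij by (auto simp: flower_def)
    moreover define g where "g = reduce (take j (us ! i))"
    have g: "g \<in> carrier F"
      unfolding g_def using ij(1) by (rule take_F)
    have yF: "[us ! i ! j] \<in> carrier F"
      using y by (auto simp: carrier_F reduced_Cons)
    have Suc: "reduce (take (Suc j) (us ! i)) = g \<otimes>\<^bsub>F\<^esub> [us ! i ! j]"
      using ij mult_reduce[of "take j (us ! i)" "[us ! i ! j]"]
      by (simp add: g_def take_Suc_conv_app_nth reduce_Cons)
    have co1: "?co (petal_vertex us i j) = K #>\<^bsub>F\<^esub> g"
      using ij co_petal[of i j] by (simp add: g_def)
    have co2: "?co (petal_vertex us i (Suc j)) = K #>\<^bsub>F\<^esub> g #>\<^bsub>F\<^esub> [us ! i ! j]"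
      using ij co_petal[of i "Suc j"] coset_mult_assoc[OF subgroup.subset[OF K] g yF]
      by (simp add: Suc)
    have "?co (petal_vertex us i (Suc j)) #>\<^bsub>F\<^esub> [inv_letter (us ! i ! j)] = K #>\<^bsub>F\<^esub> g"
      using inv_F[OF yF] g yF subgroup.subset[OF K] inv_closed[OF yF] r_inv[OF yF]
      unfolding co2 by (simp add: coset_mult_assoc m_assoc)
    ultimately show ?thesis
      using ij petal[of i j] petal[of i "Suc j"] edge[of i j] co1 co2 by auto
  qed
  have path_snoc: "path ?S p (w @ [x]) q" if "path ?S p w r" "(r, x, q) \<in> edges ?S" for p w x q r
    using that
  proof (induction w arbitrary: p)
    case Nil
    then show ?case
      using step[of r x q] by (simp del: split_paired_Ex)
  next
    case (Cons y w)
    then show ?case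
      by (simp del: split_paired_Ex) blast
  qed
  have path: "path ?S (0, 0) (take j (us ! i)) (petal_vertex us i j)"
    if "i < length us" "j \<le> length (us ! i)" for i j
    using that(2)
  proof (induction j)
    case 0
    then show ?case
      using petal[of i 0] that(1) by (simp add: petal_vertex_def)
  next
    case (Suc j)
    then show ?case
      using path_snoc[of "(0, 0)" "take j (us ! i)" "petal_vertex us i j" "us ! i ! j"]
        edge[of i j] that(1) by (simp add: take_Suc_conv_app_nth)
  qed
  have base: "base ?S = (0, 0)"
    by (simp add: flower_def)
  show ?thesis
  proof
    have "states ?S \<subseteq> insert (0, 0) (\<Union>i<length us. petal_vertex us i ` {..length (us ! i)})"
      by (auto simp: flower_def)
    then show "finite (states ?S)"
      by (rule finite_subset) auto
  next
    fix q assume "q \<in> states ?S"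
    then consider "q = (0, 0)"
      | i j where "q = petal_vertex us i j" "i < length us" "j \<le> length (us ! i)"
      by (auto simp: flower_def)
    then show "\<exists>w. path ?S (base ?S) w q"
    proof cases
      case 1
      then show ?thesis
        by (intro exI[of _ "[]"]) (simp add: flower_def)
    next
      case 2
      then show ?thesis
        using path[of i j] base by auto
    qed
  next
    fix u assume "u \<in> set us"
    then obtain i where "i < length us" "us ! i = u"
      by (auto simp: in_set_conv_nth)
    then show "path ?S (base ?S) u (base ?S)"
      using path[of i "length u"] by (simp add: base petal_vertex_def)
  next
    fix p x q assume "(p, x, q) \<in> edges ?S"
    from step[OF this]
    show "p \<in> states ?S \<and> x \<in> letters A \<and> q \<in> states ?S"
      and "(q, inv_letter x, p) \<in> edges ?S"
      and "?co q = ?co p #>\<^bsub>F\<^esub> [x]"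
      by blast+
  next
    show "base ?S \<in> states ?S" "?co (base ?S) = generate F (set us)"
      by (simp_all add: flower_def)
  qed (rule us)
qed

section \<open>The folded automaton as a part of the coset graph\<close>

locale stallings = coset_graph +
  assumes det: "deterministic S"
begin

lemma edge_unique: "(p, x, q) \<in> edges S \<Longrightarrow> (p, x, r) \<in> edges S \<Longrightarrow> q = r"
  using det unfolding deterministic_def by blast

text \<open>By determinism and the inverse edges, reading \<open>x\<close> and then its inverse
  leads back to the same vertex, so cancelling such a factor does not move the end of a
  path.\<close>

lemma path_reduce: "path S p w q \<Longrightarrow> path S p (reduce w) q"
proof (induction w arbitrary: p)
  case (Cons x w)
  then obtain r where r: "(p, x, r) \<in> edges S" "path S r (reduce w) q"
    by auto
  show ?case
  proof (cases "\<exists>v. reduce w = inv_letter x # v")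
    case True
    then obtain v where v: "reduce w = inv_letter x # v" by blast
    then obtain p' where "(r, inv_letter x, p') \<in> edges S" "path S p' v q"
      using r(2) by auto
    then have "path S p v q"
      using edge_unique[OF _ edges_inv[OF r(1)]] by blast
    then show ?thesis
      by (simp add: reduce_Cons v)
  next
    case False
    then have "reduce (x # w) = x # reduce w"
      by (cases "reduce w") (auto simp: reduce_Cons)
    then show ?thesis
      using r by auto
  qed
qed simp

lemma K_loop: "k \<in> K \<Longrightarrow> path S (base S) k (base S)"
proof (induction rule: generate.induct)
  case one
  then show ?case
    using base_state by (simp add: one_F)
next
  case (inv h)
  then show ?case
    using path_winv[OF gens_loop] gens by (auto simp: inv_F)
next
  case (eng h1 h2)
  then show ?case
    unfolding mult_F by (intro path_reduce) (auto simp: path_append)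
qed (rule gens_loop)

lemma co_path: "path S p w q \<Longrightarrow> co p \<subseteq> carrier F \<Longrightarrow> co q = co p #>\<^bsub>F\<^esub> reduce w"
proof (induction w arbitrary: p)
  case Nil
  then show ?case
    using coset_mult_one[of "co p"] by (simp add: one_F)
next
  case (Cons x w)
  then obtain r where r: "(p, x, r) \<in> edges S" "path S r w q"
    by auto
  have w: "reduce w \<in> carrier F" and x: "[x] \<in> carrier F"
    using path_letters[OF r(2)] edges_states[OF r(1)]
    by (simp_all add: reduce_in_lists carrier_F reduced_Cons del: in_lists_conv_set)
  have "co q = co p #>\<^bsub>F\<^esub> [x] #>\<^bsub>F\<^esub> reduce w"
    using Cons.IH[OF r(2)] r_coset_subset_G[OF Cons.prems(2) x] co_edge[OF r(1)] by simp
  also have "\<dots> = co p #>\<^bsub>F\<^esub> reduce (x # w)"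
    using coset_mult_assoc[OF Cons.prems(2) x w] mult_reduce[of "[x]" w] by (simp add: reduce_Cons)
  finally show ?case .
qed

lemma co_reachable: "path S (base S) w q \<Longrightarrow> co q = K #>\<^bsub>F\<^esub> reduce w"
  using co_path[of "base S" w q] K_subset by (simp add: co_base)

lemma co_rcosets: "q \<in> states S \<Longrightarrow> co q \<in> rcosets\<^bsub>F\<^esub> K"
  using reachable co_reachable path_letters reduce_in_F rcosetsI[OF K_subset] by metis

lemma co_subset: "q \<in> states S \<Longrightarrow> co q \<subseteq> carrier F"
  using co_rcosets rcosets_subset_PowG[OF subgroup_K] by blast

text \<open>A reduced path of the full coset graph between two vertices of the automaton does not leave
  the automaton.\<close>

lemma path_iff_co:
  assumes "p \<in> states S" "q \<in> states S" "w \<in> carrier F"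
  shows "path S p w q \<longleftrightarrow> co p #>\<^bsub>F\<^esub> w = co q"
proof
  assume "path S p w q"
  then show "co p #>\<^bsub>F\<^esub> w = co q"
    using co_path[of p w q] co_subset assms by (simp add: reduce_reduced carrier_F)
next
  assume eq: "co p #>\<^bsub>F\<^esub> w = co q"
  obtain s t where s: "path S (base S) s p" and t: "path S (base S) t q"
    using assms reachable by metis
  note lists = path_letters[OF s] path_letters[OF t]
  have F: "reduce s \<in> carrier F" "reduce t \<in> carrier F"
    using lists by (auto simp: reduce_in_F simp del: in_lists_conv_set)
  \<comment> \<open>\<open>k\<close> labels the round trip from the basepoint along \<open>s\<close>
    and \<open>w\<close> and back along \<open>t\<close> in the coset graph. It lies in
    \<open>K\<close>, so it can be read in the automaton; removing \<open>s\<close> and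
    \<open>t\<close> again by free reduction recovers \<open>w\<close>.\<close>
  define k where "k = reduce s \<otimes>\<^bsub>F\<^esub> w \<otimes>\<^bsub>F\<^esub> inv\<^bsub>F\<^esub> (reduce t)"
  have "K #>\<^bsub>F\<^esub> (reduce s \<otimes>\<^bsub>F\<^esub> w) = K #>\<^bsub>F\<^esub> reduce t"
    using eq coset_mult_assoc[OF K_subset F(1) assms(3)] co_reachable[OF s] co_reachable[OF t] by simp
  then have "K #>\<^bsub>F\<^esub> k = K"
    using F assms(3) K_subset by (simp add: k_def coset_mult_inv2)
  then have "k \<in> K"
    using F assms(3) subgroup_K by (intro coset_join1[of K]) (simp_all add: k_def)
  then have "path S (base S) k (base S)"
    by (rule K_loop)
  then have "path S p (winv s @ k @ t) q"
    using path_winv[OF s] t by (auto simp: path_append)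
  then have "path S p (reduce (winv s @ k @ t)) q"
    by (rule path_reduce)
  moreover have "reduce (winv s @ k @ t) = w"
  proof -
    have k: "k \<in> carrier F"
      using F assms(3) by (simp add: k_def)
    then have "reduce (winv s @ k @ t) = inv\<^bsub>F\<^esub> (reduce s) \<otimes>\<^bsub>F\<^esub> (k \<otimes>\<^bsub>F\<^esub> reduce t)"
      using lists mult_reduce[of k t] mult_reduce[of "winv s" "k @ t"]
      by (simp add: inv_reduce reduce_reduced carrier_F del: in_lists_conv_set)
    also have "\<dots> = w"
      using F assms(3) by (simp add: k_def m_assoc inv_solve_left')
    finally show ?thesis .
  qed
  ultimately show "path S p w q"
    by simp
qed

lemma co_inj: "inj_on co (states S)"
proof (rule inj_onI)
  fix p q assume *: "p \<in> states S" "q \<in> states S" "co p = co q"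
  then have "path S p \<one>\<^bsub>F\<^esub> q"
    using path_iff_co[of p q "\<one>\<^bsub>F\<^esub>"] co_subset by simp
  then show "p = q"
    by (simp add: one_F)
qed

section \<open>Transitions of the automaton\<close>

lemma next_state_eq: "next_state S x p = Some q \<longleftrightarrow> (p, x, q) \<in> edges S"
proof -
  have "(THE r. (p, x, r) \<in> edges S) = q" if "(p, x, q) \<in> edges S" for q
    using that by (rule the_equality) (rule edge_unique[OF _ that])
  then show ?thesis
    by (auto simp: next_state_def)
qed

lemma transition_eq: "transition S w p = Some q \<longleftrightarrow> path S p w q"
proof (induction w arbitrary: p)
  case (Cons x w)
  then show ?case
    by (auto simp: map_comp_Some_iff next_state_eq)
qed (auto simp: restrict_map_def)

lemma transition_append: "transition S (u @ v) = transition S v \<circ>\<^sub>m transition S u"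
proof
  fix p
  have "transition S (u @ v) p = Some q \<longleftrightarrow> (transition S v \<circ>\<^sub>m transition S u) p = Some q" for q
    by (auto simp: map_comp_Some_iff transition_eq path_append)
  then show "transition S (u @ v) p = (transition S v \<circ>\<^sub>m transition S u) p"
    by (metis not_Some_eq)
qed

lemma transition_monoid: "monoid (transition_monoid A S)"
proof
  fix f g
  assume "f \<in> carrier (transition_monoid A S)" "g \<in> carrier (transition_monoid A S)"
  then obtain u v where "u \<in> lists (letters A)" "v \<in> lists (letters A)"
    "f = transition S u" "g = transition S v"
    by (auto simp: transition_monoid_def simp del: in_lists_conv_set)
  then show "f \<otimes>\<^bsub>transition_monoid A S\<^esub> g \<in> carrier (transition_monoid A S)"
    by (auto simp: transition_monoid_def simp del: in_lists_conv_set intro!: image_eqI[of _ _ "u @ v"]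
        simp flip: transition_append)
qed (auto simp: transition_monoid_def image_iff simp del: transition.simps in_lists_conv_set
    simp flip: transition_append intro!: bexI[of _ "[]"])

lemma finite_transition_monoid: "finite (carrier (transition_monoid A S))"
proof (rule finite_subset)
  show "carrier (transition_monoid A S) \<subseteq>
      {f. dom f \<subseteq> states S \<and> ran f \<subseteq> states S}"
    by (auto simp: transition_monoid_def dom_def ran_def transition_eq dest: path_states)
  have "{f. dom f \<subseteq> states S \<and> ran f \<subseteq> states S} =
      (\<Union>D\<in>Pow (states S). {f. dom f = D \<and> ran f \<subseteq> states S})"
    by auto
  also have "finite \<dots>"
    using finite_states
    by (intro finite_UN_I finite_set_of_finite_maps) (auto intro: finite_subset)
  finally show "finite {f. dom f \<subseteq> states S \<and> ran f \<subseteq> states S}" .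
qed

end

text \<open>Induction along the foldings, started at the flower. Afterwards the automaton is used
  only through the locale, whatever generators and foldings produced it.\<close>

theorem stallings_automaton_cosets:
  assumes "stallings_automaton A K S"
  obtains T co where "stallings A T S co" "K = generate (free_group A) T"
proof -
  interpret alphabet A .
  obtain us where us: "set us \<subseteq> carrier F - {[]}" "K = generate F (set us)"
    and fold: "fold_step\<^sup>*\<^sup>* (flower us) S" and det: "deterministic S"
    using assms unfolding stallings_automaton_def by blast
  obtain co where "coset_graph A (set us) (flower us) co"
    using us(1) flower_coset_graph[of us] by blast
  with fold have "coset_graph A (set us) S co"
    by (induction rule: rtranclp_induct) (auto intro: coset_graph.fold_coset_graph)
  then have "stallings A (set us) S co"
    using det by (simp add: stallings_def stallings_axioms_def)
  then show thesis
    using us(2) that by blast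
qed

section \<open>Periodic cosets\<close>

context coset_graph
begin

text \<open>The cosets with finite orbit under right multiplication by \<open>e\<close>, taken among
  all cosets of \<open>K\<close>; that they are vertices for cyclically reduced \<open>e\<close> is
  proved in \<open>per_states\<close>.\<close>

definition per :: "'a word \<Rightarrow> 'a word set set" where
  "per e = {z \<in> rcosets\<^bsub>F\<^esub> K. \<exists>n>0. z #>\<^bsub>F\<^esub> e [^]\<^bsub>F\<^esub> (n::nat) = z}"

lemma rcosets_subset: "z \<in> rcosets\<^bsub>F\<^esub> K \<Longrightarrow> z \<subseteq> carrier F"
  using rcosets_subset_PowG[OF subgroup_K] by blast

lemma coset_assoc:
  "\<lbrakk>z \<in> rcosets\<^bsub>F\<^esub> K; g \<in> carrier F; h \<in> carrier F\<rbrakk>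
    \<Longrightarrow> z #>\<^bsub>F\<^esub> g #>\<^bsub>F\<^esub> h = z #>\<^bsub>F\<^esub> (g \<otimes>\<^bsub>F\<^esub> h)"
  using coset_mult_assoc[OF rcosets_subset] .

lemma rcosets_closed:
  assumes "z \<in> rcosets\<^bsub>F\<^esub> K" "g \<in> carrier F"
  shows "z #>\<^bsub>F\<^esub> g \<in> rcosets\<^bsub>F\<^esub> K"
proof -
  obtain w where "w \<in> carrier F" "z = K #>\<^bsub>F\<^esub> w"
    using assms(1) by (auto simp: RCOSETS_def)
  then show ?thesis
    using coset_mult_assoc[OF K_subset] assms(2) rcosetsI[OF K_subset] by simp
qed

lemma coset_one: "z \<in> rcosets\<^bsub>F\<^esub> K \<Longrightarrow> z #>\<^bsub>F\<^esub> \<one>\<^bsub>F\<^esub> = z"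
  using coset_mult_one[OF rcosets_subset] .

lemma coset_pow_fix:
  assumes "z \<in> rcosets\<^bsub>F\<^esub> K" "g \<in> carrier F" "z #>\<^bsub>F\<^esub> g [^]\<^bsub>F\<^esub> n = z"
  shows "z #>\<^bsub>F\<^esub> g [^]\<^bsub>F\<^esub> (n * j :: nat) = z"
proof (induction j)
  case (Suc j)
  have "z #>\<^bsub>F\<^esub> g [^]\<^bsub>F\<^esub> (n * Suc j) = z #>\<^bsub>F\<^esub> g [^]\<^bsub>F\<^esub> n #>\<^bsub>F\<^esub> g [^]\<^bsub>F\<^esub> (n * j)"
    using assms(1,2) by (simp add: coset_assoc nat_pow_mult)
  then show ?case
    using Suc assms(3) by simp
qed (use assms in \<open>simp add: coset_one\<close>)

lemma per_rcosets: "z \<in> per e \<Longrightarrow> z \<in> rcosets\<^bsub>F\<^esub> K"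
  by (simp add: per_def)

lemma per_commute:
  assumes "z \<in> per e" "e \<in> carrier F" "g \<in> carrier F" "e \<otimes>\<^bsub>F\<^esub> g = g \<otimes>\<^bsub>F\<^esub> e"
  shows "z #>\<^bsub>F\<^esub> g \<in> per e"
proof -
  obtain n where n: "n > 0" "z #>\<^bsub>F\<^esub> e [^]\<^bsub>F\<^esub> (n::nat) = z" and z: "z \<in> rcosets\<^bsub>F\<^esub> K"
    using assms(1) by (auto simp: per_def)
  have "g \<otimes>\<^bsub>F\<^esub> e [^]\<^bsub>F\<^esub> n = e [^]\<^bsub>F\<^esub> n \<otimes>\<^bsub>F\<^esub> g"
  proof (induction n)
    case (Suc n)
    then show ?case
      using assms(2-4) by (metis m_assoc nat_pow_Suc nat_pow_closed)
  qed (use assms in simp)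
  then have "z #>\<^bsub>F\<^esub> g #>\<^bsub>F\<^esub> e [^]\<^bsub>F\<^esub> n = z #>\<^bsub>F\<^esub> e [^]\<^bsub>F\<^esub> n #>\<^bsub>F\<^esub> g"
    using z assms(2,3) by (simp add: coset_assoc)
  then show ?thesis
    using n rcosets_closed[OF z assms(3)] by (auto simp: per_def)
qed

lemma per_pow:
  assumes "z \<in> per e" "e \<in> carrier F"
  shows "z #>\<^bsub>F\<^esub> e [^]\<^bsub>F\<^esub> (j::nat) \<in> per e" "z #>\<^bsub>F\<^esub> inv\<^bsub>F\<^esub> (e [^]\<^bsub>F\<^esub> j) \<in> per e"
proof -
  have "e \<otimes>\<^bsub>F\<^esub> e [^]\<^bsub>F\<^esub> j = e [^]\<^bsub>F\<^esub> j \<otimes>\<^bsub>F\<^esub> e"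
    using assms(2) nat_pow_Suc nat_pow_Suc2 by metis
  moreover from this have "e \<otimes>\<^bsub>F\<^esub> inv\<^bsub>F\<^esub> (e [^]\<^bsub>F\<^esub> j) = inv\<^bsub>F\<^esub> (e [^]\<^bsub>F\<^esub> j) \<otimes>\<^bsub>F\<^esub> e"
    using assms(2) by (metis inv_closed inv_solve_left inv_solve_right m_assoc m_closed nat_pow_closed)
  ultimately show "z #>\<^bsub>F\<^esub> e [^]\<^bsub>F\<^esub> j \<in> per e" "z #>\<^bsub>F\<^esub> inv\<^bsub>F\<^esub> (e [^]\<^bsub>F\<^esub> j) \<in> per e"
    using assms by (simp_all add: per_commute)
qed

lemma per_inv:
  assumes "e \<in> carrier F"
  shows "per (inv\<^bsub>F\<^esub> e) = per e"
proof -
  have "z \<in> per (inv\<^bsub>F\<^esub> e)" if ze: "z \<in> per e" "e \<in> carrier F" for z e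
  proof -
    obtain n where n: "n > 0" "z #>\<^bsub>F\<^esub> e [^]\<^bsub>F\<^esub> (n::nat) = z" and z: "z \<in> rcosets\<^bsub>F\<^esub> K"
      using ze(1) by (auto simp: per_def)
    have "z #>\<^bsub>F\<^esub> inv\<^bsub>F\<^esub> e [^]\<^bsub>F\<^esub> n = z #>\<^bsub>F\<^esub> e [^]\<^bsub>F\<^esub> n #>\<^bsub>F\<^esub> inv\<^bsub>F\<^esub> (e [^]\<^bsub>F\<^esub> n)"
      using n(2) that(2) by (simp add: nat_pow_inv)
    also have "\<dots> = z"
      using z that(2) by (simp add: coset_assoc coset_one)
    finally show ?thesis
      using n(1) z by (auto simp: per_def)
  qed
  from this[of _ e] this[of _ "inv\<^bsub>F\<^esub> e"] assms show ?thesis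
    by auto
qed

lemma per_period:
  assumes "finite (per e)" "e \<in> carrier F"
  obtains N :: nat where "N > 0" "\<And>z. z \<in> per e \<Longrightarrow> z #>\<^bsub>F\<^esub> e [^]\<^bsub>F\<^esub> N = z"
proof -
  have "\<forall>z\<in>per e. \<exists>n>0. z #>\<^bsub>F\<^esub> e [^]\<^bsub>F\<^esub> (n::nat) = z"
    by (simp add: per_def)
  then obtain n where n: "\<And>z. z \<in> per e \<Longrightarrow> n z > 0 \<and> z #>\<^bsub>F\<^esub> e [^]\<^bsub>F\<^esub> (n z :: nat) = z"
    by metis
  \<comment> \<open>The product of the individual periods is a multiple of each, hence a common
    period.\<close>
  define N where "N = prod n (per e)"
  have "N > 0"
    using n unfolding N_def by (intro prod_pos) auto
  moreover have "z #>\<^bsub>F\<^esub> e [^]\<^bsub>F\<^esub> N = z" if z: "z \<in> per e" for z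
  proof -
    have "N = n z * prod n (per e - {z})"
      unfolding N_def using assms(1) z by (rule prod.remove)
    then show ?thesis
      using coset_pow_fix[OF per_rcosets[OF z] assms(2)] n[OF z] by simp
  qed
  ultimately show thesis
    by (rule that)
qed

end

text \<open>Multiplication by \<open>x\<close> cancels at most \<open>length x\<close> letters of
  \<open>e^M\<close>, and the last \<open>M - m\<close> copies of \<open>e\<close> provide that
  many.\<close>

lemma (in alphabet) pow_absorb:
  assumes "cyc_reduced e" "e \<in> carrier F" "x \<in> carrier F" "M \<ge> m + length x"
  obtains t where "e [^]\<^bsub>F\<^esub> M \<otimes>\<^bsub>F\<^esub> x = wpow e m @ t"
proof -
  have e: "e \<noteq> []"
    using assms(1) by (simp add: cyc_reduced_def)
  define j where "j = M - m"
  have M: "wpow e M = wpow e m @ wpow e j"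
    using assms(4) by (simp add: j_def flip: wpow_add)
  have "length x \<le> length (wpow e j)"
    using length_wpow_ge[OF e, of j] assms(4) unfolding j_def by linarith
  moreover have "reduced (wpow e m @ wpow e j)" "reduced x"
    using assms(1,3) reduced_wpow[of e M] by (simp_all add: M carrier_F)
  ultimately obtain t where "reduce ((wpow e m @ wpow e j) @ x) = wpow e m @ t"
    by (elim reduce_append_prefix)
  then show thesis
    using that assms(1,2) by (simp add: pow_F mult_F M)
qed

section \<open>Periodic cosets as vertices of the automaton\<close>

context stallings
begin

text \<open>A power of \<open>e\<close> fixes the coset, so \<open>s e^m s^-1\<close> lies in
  \<open>K\<close>. Nothing cancels between \<open>s\<close> and \<open>e^m\<close>, and
  \<open>s^-1\<close> cancels only inside \<open>e^m\<close>, so the reduced word begins with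
  \<open>s\<close>. As a loop at the basepoint it makes \<open>s\<close> readable.\<close>

lemma per_states_aux:
  assumes "cyc_reduced e" "e \<in> carrier F" "s \<in> carrier F" "K #>\<^bsub>F\<^esub> s \<in> per e"
    and "s = [] \<or> hd e \<noteq> inv_letter (last s)"
  shows "K #>\<^bsub>F\<^esub> s \<in> co ` states S"
proof -
  have "K #>\<^bsub>F\<^esub> s \<in> rcosets\<^bsub>F\<^esub> K"
    using assms(3) by (rule rcosetsI[OF K_subset])
  then obtain n where n: "n > 0" "K #>\<^bsub>F\<^esub> s #>\<^bsub>F\<^esub> e [^]\<^bsub>F\<^esub> (n::nat) = K #>\<^bsub>F\<^esub> s"
    using assms(4) by (auto simp: per_def)
  \<comment> \<open>A multiple of the period \<open>n\<close> large enough for \<open>e^m\<close> to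
    be at least as long as \<open>s\<close>.\<close>
  define m where "m = n * length s"
  have e: "e \<noteq> []" "reduced e" "reduced s"
    using assms(1,3) by (auto simp: cyc_reduced_def carrier_F)
  have "length s \<le> m"
    using n(1) by (simp add: m_def)
  then have len: "length (winv s) \<le> length (wpow e m)"
    using length_wpow_ge[OF e(1), of m] by (simp only: length_winv)
  have "K #>\<^bsub>F\<^esub> (s \<otimes>\<^bsub>F\<^esub> e [^]\<^bsub>F\<^esub> m) = K #>\<^bsub>F\<^esub> s"
    using coset_pow_fix[OF \<open>K #>\<^bsub>F\<^esub> s \<in> rcosets\<^bsub>F\<^esub> K\<close> assms(2) n(2)] assms(2,3)
      coset_mult_assoc[OF K_subset] by (simp add: m_def)
  then have k: "s \<otimes>\<^bsub>F\<^esub> e [^]\<^bsub>F\<^esub> m \<otimes>\<^bsub>F\<^esub> inv\<^bsub>F\<^esub> s \<in> K"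
    using assms(2,3) K_subset subgroup_K by (intro coset_join1[of K] coset_mult_inv2) auto
  have red: "reduced (s @ wpow e m)"
    using assms(1,5) e reduced_wpow[OF assms(1), of m]
    by (cases "m = 0") (auto simp: reduced_append hd_wpow)
  obtain t where "reduce ((s @ wpow e m) @ winv s) = s @ t"
    using reduce_append_prefix[OF red _ len] e by auto
  then have "s @ t \<in> K"
    using k red assms(1-3) by (simp add: mult_F pow_F inv_F reduce_reduced)
  then obtain q where q: "path S (base S) s q"
    using K_loop path_append by blast
  then have "co q = K #>\<^bsub>F\<^esub> s"
    using co_reachable e(3) by (simp add: reduce_reduced)
  then show ?thesis
    using path_states[OF q] by (intro image_eqI[of _ _ q]) auto
qed

text \<open>The cosets outside the automaton lie on trees attached to it, so a nontrivial closed path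
  through such a coset starts with a letter and ends with the inverse of that letter.\<close>

lemma per_states:
  assumes "cyc_reduced e" "e \<in> carrier F"
  shows "per e \<subseteq> co ` states S"
proof
  fix z assume z: "z \<in> per e"
  then obtain s where s: "s \<in> carrier F" "z = K #>\<^bsub>F\<^esub> s"
    by (auto simp: per_def RCOSETS_def)
  show "z \<in> co ` states S"
  proof (cases "s = [] \<or> hd e \<noteq> inv_letter (last s)")
    case True
    then show ?thesis
      using per_states_aux[of e s] assms s z by simp
  next
    case False
    \<comment> \<open>Here \<open>s\<close> ends in the inverse of the first letter of
      \<open>e\<close>, hence not in the last letter of \<open>e\<close>. So \<open>winv e\<close>,
      which has the same periodic cosets, can follow \<open>s\<close> without cancellation.\<close>
    then have "hd (winv e) \<noteq> inv_letter (last s)"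
      using assms(1) by (auto simp: cyc_reduced_def hd_winv inv_letter_eq_iff)
    then show ?thesis
      using per_states_aux[of "winv e" s] assms s z winv_in_F[of e] per_inv[of e] by (simp add: inv_F)
  qed
qed

lemma finite_per: "cyc_reduced e \<Longrightarrow> e \<in> carrier F \<Longrightarrow> finite (per e)"
  using per_states finite_states by (meson finite_imageI finite_subset)

text \<open>The \<open>m + 1\<close> vertices reached by \<open>e^0, ..., e^m\<close> cannot all be
  distinct. If those for \<open>i < j\<close> coincide, cancelling \<open>e^i\<close> on the right
  shows that \<open>e^(j - i)\<close> fixes \<open>co p\<close>.\<close>

lemma long_path_per:
  assumes "cyc_reduced e" "e \<in> carrier F" "path S p (wpow e m) q" "card (states S) \<le> m"
  shows "co p \<in> per e"
proof -
  have p: "p \<in> states S"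
    using path_states[OF assms(3)] by simp
  have "\<exists>r. path S p (wpow e i) r" if "i \<le> m" for i
    using assms(3) wpow_add[of e i "m - i"] that by (auto simp: path_append)
  then obtain r where r: "\<And>i. i \<le> m \<Longrightarrow> path S p (wpow e i) (r i)"
    by metis
  have "r ` {..m} \<subseteq> states S"
    using r path_states by auto
  then have "card (r ` {..m}) < card {..m}"
    using card_mono[OF finite_states, of "r ` {..m}"] assms(4) by simp
  then have "\<not> inj_on r {..m}"
    by (rule pigeonhole)
  then obtain i j where ij: "i < j" "j \<le> m" "r i = r j"
    by (metis atMost_iff linorder_inj_onI')
  have co_r: "co p #>\<^bsub>F\<^esub> e [^]\<^bsub>F\<^esub> l = co (r l)" if "l \<le> m" for l
    using r[OF that] path_iff_co[of p "r l" "wpow e l"] path_states[OF r[OF that]]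
      pow_F[OF assms(1,2)] nat_pow_closed[OF assms(2), of l] by simp
  have "co p #>\<^bsub>F\<^esub> e [^]\<^bsub>F\<^esub> (j - i) #>\<^bsub>F\<^esub> e [^]\<^bsub>F\<^esub> i = co p #>\<^bsub>F\<^esub> e [^]\<^bsub>F\<^esub> i"
    using co_r[of i] co_r[of j] ij assms(2) co_rcosets[OF p] by (simp add: coset_assoc nat_pow_mult)
  then have "co p #>\<^bsub>F\<^esub> e [^]\<^bsub>F\<^esub> (j - i) #>\<^bsub>F\<^esub> e [^]\<^bsub>F\<^esub> i #>\<^bsub>F\<^esub> inv\<^bsub>F\<^esub> (e [^]\<^bsub>F\<^esub> i)
      = co p #>\<^bsub>F\<^esub> e [^]\<^bsub>F\<^esub> i #>\<^bsub>F\<^esub> inv\<^bsub>F\<^esub> (e [^]\<^bsub>F\<^esub> i)"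
    by simp
  then have "co p #>\<^bsub>F\<^esub> e [^]\<^bsub>F\<^esub> (j - i) = co p"
    using assms(2) co_rcosets[OF p] by (simp add: coset_assoc m_assoc coset_one)
  then show ?thesis
    using ij(1) co_rcosets[OF p] unfolding per_def by (auto intro!: exI[of _ "j - i"])
qed

lemma prefix_per:
  assumes "cyc_reduced e" "e \<in> carrier F" "path S p (wpow e (card (states S)) @ t) q"
  shows "co p \<in> per e"
  using long_path_per assms by (metis order_refl path_append)

text \<open>If \<open>e\<close> has as few periodic cosets as possible, these are permuted by every \<open>x\<close>: the element
  \<open>h = e\<^sup>M x e\<^sup>j\<close> with \<open>M\<close> much larger than \<open>j\<close> is cyclically reduced and starts with a
  large power of \<open>e\<close>, so each of its periodic cosets is periodic for \<open>e\<close>.\<close>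

lemma per_minimal_invariant:
  assumes L: "subgroup L F" and e: "cyc_reduced e" "e \<in> L"
    and min: "\<And>h. h \<in> L \<Longrightarrow> cyc_reduced h \<Longrightarrow> card (per e) \<le> card (per h)"
    and x: "x \<in> L" and z: "z \<in> per e"
  shows "z #>\<^bsub>F\<^esub> x \<in> per e"
proof -
  have F: "e \<in> carrier F" "x \<in> carrier F"
    using subgroup.subset[OF L] e(2) x by auto
  have e': "e \<noteq> []"
    using e(1) by (simp add: cyc_reduced_def)
  have pow_L: "e [^]\<^bsub>F\<^esub> (j::nat) \<in> L" for j
    by (induction j) (auto intro: subgroup.m_closed[OF L] subgroup.one_closed[OF L] e)
  \<comment> \<open>One copy of \<open>e\<close> more than the \<open>length x\<close> copies that
    suffice to absorb \<open>x\<close>, so that \<open>y\<close> still ends with a full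
    \<open>e\<close>.\<close>
  define j where "j = Suc (length x)"
  define y where "y = x \<otimes>\<^bsub>F\<^esub> e [^]\<^bsub>F\<^esub> j"
  have yL: "y \<in> L"
    unfolding y_def by (intro subgroup.m_closed[OF L] x pow_L)
  then have yF: "y \<in> carrier F"
    using subgroup.subset[OF L] by auto
  have y_red: "reduced y"
    using yF by (simp add: carrier_F)
  have ej: "wpow e j = wpow e (length x) @ e"
    unfolding j_def by (rule wpow_Suc_right)
  have "reduced x" "reduced (wpow e (length x) @ e)"
    using F(2) reduced_wpow[OF e(1), of j] by (simp_all add: carrier_F ej)
  then obtain t where "reduce (x @ (wpow e (length x) @ e)) = t @ e"
    using reduce_append_suffix length_wpow_ge[OF e', of "length x"] by metis
  then have y: "y = t @ e"
    using e(1) F by (simp add: y_def mult_F pow_F ej)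
  \<comment> \<open>The number of copies of \<open>e\<close> that \<open>prefix_per\<close> needs,
    plus one, so that \<open>h\<close> visibly starts with the first letter of
    \<open>e\<close>.\<close>
  define m where "m = Suc (card (states S))"
  define M where "M = m + length y"
  define h where "h = e [^]\<^bsub>F\<^esub> M \<otimes>\<^bsub>F\<^esub> y"
  have hL: "h \<in> L"
    unfolding h_def by (intro subgroup.m_closed[OF L] yL pow_L)
  then have hF: "h \<in> carrier F"
    using subgroup.subset[OF L] by auto
  obtain t' where h: "h = wpow e m @ t'"
    unfolding h_def using pow_absorb[OF e(1) F(1) yF, of m M] by (auto simp: M_def)
  have "hd h = hd e" "h \<noteq> []"
    using e' by (auto simp: h m_def)
  moreover have "last h = last e"
  proof -
    obtain p s v where d: "wpow e M = p @ s" "y = winv s @ v" "reduce (wpow e M @ y) = p @ v"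
      using reduce_append_cancel[OF reduced_wpow[OF e(1)] y_red] by blast
    \<comment> \<open>If \<open>y\<close> cancelled entirely, its inverse, which starts with
      \<open>winv e\<close>, would be a suffix of \<open>e^M\<close>; but no power of
      \<open>e\<close> contains \<open>winv e\<close>.\<close>
    have "v \<noteq> []"
    proof
      assume "v = []"
      then have "s = winv y"
        using d(2) by simp
      then have "wpow e M = p @ winv e @ winv t"
        using d(1) y by simp
      then show False
        using winv_not_factor_wpow[OF e(1)] by blast
    qed
    then have "last v = last y"
      using d(2) by simp
    moreover have "h = p @ v"
      using d(3) e(1) F by (simp add: h_def pow_F mult_F)
    ultimately show ?thesis
      using \<open>v \<noteq> []\<close> y e' by simp
  qed
  ultimately have h_cyc: "cyc_reduced h"
    using e(1) hF by (simp add: cyc_reduced_def carrier_F)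
  \<comment> \<open>A coset periodic for \<open>h\<close> and its translate by \<open>h\<close> are
    both vertices, so \<open>h\<close>, with its long initial power of \<open>e\<close>, can be read
    from the first to the second.\<close>
  have "per h \<subseteq> per e"
  proof
    fix z assume zh: "z \<in> per h"
    have zh1: "z #>\<^bsub>F\<^esub> h \<in> per h"
      using per_pow(1)[OF zh hF, of 1] hF by simp
    obtain p q where pq: "p \<in> states S" "z = co p" "q \<in> states S" "z #>\<^bsub>F\<^esub> h = co q"
      using per_states[OF h_cyc hF] zh zh1 by blast
    then have "path S p h q"
      using path_iff_co[of p q h] hF by simp
    moreover have "h = wpow e (card (states S)) @ (e @ t')"
      unfolding h m_def by (simp only: wpow_Suc_right append_assoc)
    ultimately show "z \<in> per e"
      using prefix_per[OF e(1) F(1)] pq(2) by metis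
  qed
  then have per_eq: "per h = per e"
    using min[OF hL h_cyc] card_subset_eq[OF finite_per[OF e(1) F(1)]] card_mono[OF finite_per[OF e(1) F(1)]]
    by (metis order_antisym)
  \<comment> \<open>The set is now invariant under both \<open>e\<close> and \<open>h\<close> and
    their inverses, so \<open>z\<close> can be moved by \<open>x = e^-M h e^-j\<close> one factor at
    a time.\<close>
  define z1 where "z1 = z #>\<^bsub>F\<^esub> inv\<^bsub>F\<^esub> (e [^]\<^bsub>F\<^esub> M)"
  have zr: "z \<in> rcosets\<^bsub>F\<^esub> K"
    using z by (rule per_rcosets)
  have "z1 \<in> per h"
    unfolding z1_def per_eq using per_pow(2)[OF z F(1)] .
  then have "z1 #>\<^bsub>F\<^esub> h \<in> per e"
    using per_pow(1)[of z1 h 1] hF per_eq by simp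
  moreover have "z1 #>\<^bsub>F\<^esub> h = z #>\<^bsub>F\<^esub> y"
    unfolding z1_def h_def using zr F(1) yF by (simp add: coset_assoc flip: m_assoc)
  ultimately have "z #>\<^bsub>F\<^esub> y #>\<^bsub>F\<^esub> inv\<^bsub>F\<^esub> (e [^]\<^bsub>F\<^esub> j) \<in> per e"
    using per_pow(2)[of "z #>\<^bsub>F\<^esub> y"] F(1) by simp
  moreover have "z #>\<^bsub>F\<^esub> y #>\<^bsub>F\<^esub> inv\<^bsub>F\<^esub> (e [^]\<^bsub>F\<^esub> j) = z #>\<^bsub>F\<^esub> x"
    unfolding y_def using zr F by (simp add: coset_assoc m_assoc)
  ultimately show ?thesis
    by simp
qed

text \<open>Right multiplication by \<open>g\<close> on \<open>per e\<close>, transported to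
  vertices along \<open>co\<close>. The values are meaningful when \<open>per e\<close> is invariant
  under \<open>g\<close> and consists of vertices.\<close>

definition per_act :: "'a word \<Rightarrow> 'a word \<Rightarrow> 'b \<rightharpoonup> 'b" where
  "per_act e g p = (if p \<in> states S \<and> co p \<in> per e
     then Some (the_inv_into (states S) co (co p #>\<^bsub>F\<^esub> g)) else None)"

lemma per_act_eq:
  assumes "cyc_reduced e" "e \<in> carrier F" "\<And>z. z \<in> per e \<Longrightarrow> z #>\<^bsub>F\<^esub> g \<in> per e"
  shows "per_act e g p = Some q \<longleftrightarrow>
    p \<in> states S \<and> q \<in> states S \<and> co p \<in> per e \<and> co q = co p #>\<^bsub>F\<^esub> g"
proof -
  have "co p #>\<^bsub>F\<^esub> g \<in> co ` states S" if "co p \<in> per e"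
    using assms(3)[OF that] per_states[OF assms(1,2)] by blast
  then show ?thesis
    using the_inv_into_f_f[OF co_inj, of q] f_the_inv_into_f[OF co_inj, of "co p #>\<^bsub>F\<^esub> g"]
      the_inv_into_into[OF co_inj, of "co p #>\<^bsub>F\<^esub> g" "states S"]
    by (auto simp: per_act_def)
qed

text \<open>The witness is the reduced form of \<open>e^M g\<close>: it acts like \<open>g\<close>
  on \<open>per e\<close>, and its long initial power of \<open>e\<close> makes it unreadable from
  any other vertex.\<close>

lemma per_act_in_transition_monoid:
  assumes "cyc_reduced e" "e \<in> carrier F" "g \<in> carrier F"
    and inv: "\<And>z. z \<in> per e \<Longrightarrow> z #>\<^bsub>F\<^esub> g \<in> per e"
  shows "per_act e g \<in> carrier (transition_monoid A S)"
proof -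
  obtain N :: nat where N: "N > 0" "\<And>z. z \<in> per e \<Longrightarrow> z #>\<^bsub>F\<^esub> e [^]\<^bsub>F\<^esub> N = z"
    using per_period[OF finite_per[OF assms(1,2)] assms(2)] by blast
  \<comment> \<open>A multiple of the common period, so that \<open>e^M\<close> fixes
    \<open>per e\<close> pointwise, and large enough for \<open>card (states S)\<close> copies of
    \<open>e\<close> to survive multiplication by \<open>g\<close>.\<close>
  define M where "M = N * (card (states S) + length g)"
  define w where "w = e [^]\<^bsub>F\<^esub> M \<otimes>\<^bsub>F\<^esub> g"
  have M: "M \<ge> card (states S) + length g"
    using N(1) by (simp add: M_def)
  obtain t where t: "w = wpow e (card (states S)) @ t"
    unfolding w_def using pow_absorb[OF assms(1-3) M] by blast
  have wF: "w \<in> carrier F"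
    using assms(2,3) by (simp add: w_def)
  have act: "z #>\<^bsub>F\<^esub> w = z #>\<^bsub>F\<^esub> g" if "z \<in> per e" for z
  proof -
    have "z #>\<^bsub>F\<^esub> w = z #>\<^bsub>F\<^esub> e [^]\<^bsub>F\<^esub> M #>\<^bsub>F\<^esub> g"
      using per_rcosets[OF that] assms(2,3) by (simp add: w_def coset_assoc)
    then show ?thesis
      using coset_pow_fix[OF per_rcosets[OF that] assms(2) N(2)[OF that]] by (simp add: M_def)
  qed
  have "per_act e g p = Some q \<longleftrightarrow> transition S w p = Some q" for p q
    unfolding per_act_eq[of e, OF assms(1,2) inv, simplified] transition_eq
  proof (intro iffI)
    assume "p \<in> states S \<and> q \<in> states S \<and> co p \<in> per e \<and> co q = co p #>\<^bsub>F\<^esub> g"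
    then show "path S p w q"
      using path_iff_co[of p q w] wF act by simp
  next
    assume path: "path S p w q"
    then have "co p \<in> per e"
      unfolding t by (rule prefix_per[OF assms(1,2)])
    then show "p \<in> states S \<and> q \<in> states S \<and> co p \<in> per e \<and> co q = co p #>\<^bsub>F\<^esub> g"
      using path_iff_co[of p q w] path_states[OF path] path wF act by simp
  qed
  then have "per_act e g = transition S w"
    by (metis ext not_Some_eq)
  then show ?thesis
    using wF by (auto simp: transition_monoid_def carrier_F simp del: in_lists_conv_set)
qed

end

section \<open>Subgroups of transition monoids\<close>

text \<open>\<open>H\<close> contains groups over \<open>nat\<close> only, so \<open>U\<close> is
  first copied to a group \<open>P\<close> over \<open>nat\<close>, carried by the image of a
  section \<open>s\<close> of the epimorphism \<open>k\<close> from a member \<open>N\<close>. Then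
  \<open>s\<close> after \<open>k\<close> shows \<open>P\<close> to be an image of
  \<open>N\<close>.\<close>

lemma in_class_epi:
  assumes H: "pseudovariety H" and G: "in_class G H" "group G"
    and f: "f \<in> epi G U" and U: "group U"
  shows "in_class U H"
proof -
  interpret U: group U by (rule U)
  obtain N h where N: "N \<in> H" and h: "h \<in> iso N G"
    using G group.iso_set_sym[OF G(2)] unfolding in_class_def is_iso_def by blast
  define k where "k = f \<circ> h"
  have k: "k \<in> hom N U" "k ` carrier N = carrier U"
    using f h unfolding k_def epi_def iso_iff image_comp[symmetric]
    by (auto intro: hom_compose)
  define s where "s = inv_into (carrier N) k"
  have ks: "k (s a) = a" if "a \<in> carrier U" for a
    unfolding s_def using k(2) that by (intro f_inv_into_f) simp
  define P where "P = \<lparr>carrier = s ` carrier U, mult = (\<lambda>a b. s (k a \<otimes>\<^bsub>U\<^esub> k b)),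
    one = s \<one>\<^bsub>U\<^esub>\<rparr>"
  have sP: "s \<in> hom U P"
    by (auto simp: hom_def P_def ks)
  then have P: "group P"
    using U.hom_imp_img_group[of s P] by (simp add: P_def)
  have "inj_on s (carrier U)"
    using ks by (rule inj_on_inverseI)
  then have "s \<in> iso U P"
    using sP by (simp add: iso_iff P_def)
  moreover have "s \<circ> k \<in> epi N P"
    using hom_compose[OF k(1) sP] image_comp[of s k "carrier N"] k(2) by (simp add: epi_def P_def)
  then have "P \<in> H"
    using H N P unfolding pseudovariety_def by blast
  ultimately show ?thesis
    unfolding in_class_def is_iso_def by blast
qed

lemma overline_class_epi:
  assumes "pseudovariety H" "M \<in> overline_class H"
    and "V \<subseteq> carrier M" "group (M\<lparr>carrier := V, one := i\<rparr>)"
    and "f \<in> epi (M\<lparr>carrier := V, one := i\<rparr>) U" "group U"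
  shows "in_class U H"
  using assms(2-4) in_class_epi[OF assms(1) _ assms(4,5,6)] unfolding overline_class_def by blast

text \<open>The one-element subgroup at the identity of \<open>M\<close> maps onto
  \<open>U\<close>.\<close>

lemma overline_class_trivial:
  assumes H: "pseudovariety H" and M: "M \<in> overline_class H"
    and U: "group U" "carrier U = {\<one>\<^bsub>U\<^esub>}"
  shows "in_class U H"
proof -
  interpret monoid M
    using M by (simp add: overline_class_def)
  interpret U: group U by (rule U)
  let ?V = "M\<lparr>carrier := {\<one>\<^bsub>M\<^esub>}, one := \<one>\<^bsub>M\<^esub>\<rparr>"
  have "group ?V"
    by (rule groupI) auto
  moreover have "(\<lambda>_. \<one>\<^bsub>U\<^esub>) \<in> epi ?V U"
    using U(2) by (auto simp: epi_def hom_def)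
  ultimately show ?thesis
    using overline_class_epi[OF H M] U(1) by blast
qed

section \<open>Groups induced on cosets and subgroups of the transition monoid\<close>

context stallings
begin

text \<open>The hypotheses on \<open>\<theta>\<close> say that \<open>U\<close> is the permutation group that \<open>L\<close> induces on \<open>Y\<close>.\<close>

lemma in_class_of_minimal:
  assumes H: "pseudovariety H" "transition_monoid A S \<in> overline_class H"
    and L: "subgroup L F" and U: "group U" "finite (carrier U)"
    and \<theta>: "\<theta> \<in> epi (F\<lparr>carrier := L\<rparr>) U"
    and Y: "Y \<subseteq> rcosets\<^bsub>F\<^esub> K"
    and fix_iff: "\<And>g. g \<in> L \<Longrightarrow> \<theta> g = \<one>\<^bsub>U\<^esub> \<longleftrightarrow> (\<forall>y\<in>Y. y #>\<^bsub>F\<^esub> g = y)"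
    and e: "cyc_reduced e" "e \<in> L"
    and min: "\<And>h. h \<in> L \<Longrightarrow> cyc_reduced h \<Longrightarrow> card (per e) \<le> card (per h)"
  shows "in_class U H"
proof -
  interpret L: group "F\<lparr>carrier := L\<rparr>"
    by (rule subgroup.subgroup_is_group[OF L is_group])
  interpret U: group U by (rule U)
  interpret \<theta>: group_hom "F\<lparr>carrier := L\<rparr>" U \<theta>
    using \<theta> by unfold_locales (simp add: epi_def)
  have LF: "g \<in> carrier F" if "g \<in> L" for g
    using that subgroup.subset[OF L] by auto
  have e_pow: "e [^]\<^bsub>F\<^esub> (n::nat) \<in> L" for n
    by (induction n) (auto intro: subgroup.m_closed[OF L] subgroup.one_closed[OF L] e)
  \<comment> \<open>\<open>\<theta> e\<close> has finite order in \<open>U\<close>, so a positive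
    power of \<open>e\<close> lies in the kernel of \<open>\<theta>\<close> and fixes
    \<open>Y\<close> pointwise.\<close>
  have "Y \<subseteq> per e"
  proof
    fix y assume y: "y \<in> Y"
    define n where "n = order U"
    have "n > 0"
      using U(2) U.order_gt_0_iff_finite by (simp add: n_def)
    have "\<theta> (e [^]\<^bsub>F\<^esub> n) = \<theta> e [^]\<^bsub>U\<^esub> n"
      using \<theta>.hom_nat_pow[of e n] e(2) by (simp flip: nat_pow_consistent)
    also have "\<dots> = \<one>\<^bsub>U\<^esub>"
      unfolding n_def using e(2) by (intro U.pow_order_eq_1) (simp add: \<theta>.hom_closed[simplified])
    finally have "y #>\<^bsub>F\<^esub> e [^]\<^bsub>F\<^esub> n = y"
      using fix_iff[OF e_pow] y by blast
    then show "y \<in> per e"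
      using y Y \<open>n > 0\<close> by (auto simp: per_def)
  qed
  let ?M = "transition_monoid A S"
  let ?\<rho> = "per_act e"
  have inv: "z #>\<^bsub>F\<^esub> g \<in> per e" if "z \<in> per e" "g \<in> L" for z g
    using per_minimal_invariant[OF L e min that(2,1)] .
  have \<rho>_eq: "?\<rho> g p = Some q \<longleftrightarrow>
      p \<in> states S \<and> q \<in> states S \<and> co p \<in> per e \<and> co q = co p #>\<^bsub>F\<^esub> g"
    if "g \<in> L" for g p q
    using per_act_eq[of e g p q] e LF[OF e(2)] inv that by blast
  have \<rho>_M: "?\<rho> g \<in> carrier ?M" if "g \<in> L" for g
    using per_act_in_transition_monoid[of e g] e LF inv that by blast
  have \<rho>_mult: "?\<rho> (g \<otimes>\<^bsub>F\<^esub> h) = ?\<rho> h \<circ>\<^sub>m ?\<rho> g" if gh: "g \<in> L" "h \<in> L" for g h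
  proof -
    have "?\<rho> (g \<otimes>\<^bsub>F\<^esub> h) p = Some r \<longleftrightarrow> (?\<rho> h \<circ>\<^sub>m ?\<rho> g) p = Some r" for p r
    proof (cases "p \<in> states S \<and> co p \<in> per e")
      case True
      then obtain q where q: "q \<in> states S" "co q = co p #>\<^bsub>F\<^esub> g"
        using inv[of "co p" g] gh(1) per_states[OF e(1) LF[OF e(2)]] by blast
      have "?\<rho> g p = Some q"
        using True q gh(1) by (simp add: \<rho>_eq)
      moreover have "co q #>\<^bsub>F\<^esub> h = co p #>\<^bsub>F\<^esub> (g \<otimes>\<^bsub>F\<^esub> h)"
        using True q gh LF by (simp add: coset_assoc co_rcosets)
      ultimately show ?thesis
        using True q gh inv[of "co p" g] subgroup.m_closed[OF L gh] by (simp add: \<rho>_eq)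
    next
      case False
      then have "?\<rho> g p = None"
        by (auto simp: per_act_def)
      then show ?thesis
        using False subgroup.m_closed[OF L gh] by (auto simp: \<rho>_eq)
    qed
    then show ?thesis
      by (metis ext not_Some_eq)
  qed
  have \<rho>_hom: "?\<rho> \<in> hom (F\<lparr>carrier := L\<rparr>) ?M"
    using \<rho>_M \<rho>_mult by (auto simp: hom_def transition_monoid_def)
  \<comment> \<open>Its identity is the partial identity on the vertices in \<open>per e\<close>,
    which may differ from the identity of the transition monoid.\<close>
  define V where "V = ?M\<lparr>carrier := ?\<rho> ` L, one := ?\<rho> \<one>\<^bsub>F\<^esub>\<rparr>"
  have V: "group V"
    using L.hom_imp_img_group[OF \<rho>_hom] by (simp add: V_def)
  \<comment> \<open>Equal action on \<open>per e\<close> implies equal action on its subset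
    \<open>Y\<close>, which determines \<open>\<theta>\<close>. So \<open>\<theta>\<close> factors
    through \<open>?\<rho>\<close>, by the map \<open>f\<close> below.\<close>
  have \<theta>_eq: "\<theta> g = \<theta> h" if gh: "g \<in> L" "h \<in> L" and eq: "?\<rho> g = ?\<rho> h" for g h
  proof -
    have ghL: "g \<otimes>\<^bsub>F\<^esub> inv\<^bsub>F\<^esub> h \<in> L"
      using gh by (intro subgroup.m_closed[OF L] subgroup.m_inv_closed[OF L])
    have "y #>\<^bsub>F\<^esub> (g \<otimes>\<^bsub>F\<^esub> inv\<^bsub>F\<^esub> h) = y" if "y \<in> Y" for y
    proof -
      have y: "y \<in> per e"
        using that \<open>Y \<subseteq> per e\<close> by auto
      obtain p where p: "p \<in> states S" "y = co p"
        using y per_states[OF e(1) LF[OF e(2)]] by blast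
      obtain q where q: "q \<in> states S" "y #>\<^bsub>F\<^esub> g = co q"
        using inv[OF y gh(1)] per_states[OF e(1) LF[OF e(2)]] by blast
      have "?\<rho> h p = Some q"
        using \<rho>_eq[OF gh(1), of p q] p q y eq by simp
      then have "y #>\<^bsub>F\<^esub> g = y #>\<^bsub>F\<^esub> h"
        using \<rho>_eq[OF gh(2), of p q] p q by simp
      then show ?thesis
        using coset_mult_inv2[of y g h] gh LF per_rcosets[OF y] rcosets_subset by blast
    qed
    then have "\<theta> (g \<otimes>\<^bsub>F\<^esub> inv\<^bsub>F\<^esub> h) = \<one>\<^bsub>U\<^esub>"
      using fix_iff[OF ghL] by blast
    moreover have "\<theta> (g \<otimes>\<^bsub>F\<^esub> inv\<^bsub>F\<^esub> h \<otimes>\<^bsub>F\<^esub> h) = \<theta> (g \<otimes>\<^bsub>F\<^esub> inv\<^bsub>F\<^esub> h) \<otimes>\<^bsub>U\<^esub> \<theta> h"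
      using \<theta>.hom_mult[of "g \<otimes>\<^bsub>F\<^esub> inv\<^bsub>F\<^esub> h" h] ghL gh by simp
    moreover have "g \<otimes>\<^bsub>F\<^esub> inv\<^bsub>F\<^esub> h \<otimes>\<^bsub>F\<^esub> h = g"
      using gh LF by (simp add: m_assoc)
    moreover have "\<theta> h \<in> carrier U"
      using \<theta>.hom_closed[of h] gh by simp
    ultimately show ?thesis
      by simp
  qed
  define f where "f = \<theta> \<circ> inv_into L ?\<rho>"
  have f: "f (?\<rho> g) = \<theta> g" if "g \<in> L" for g
    unfolding f_def comp_def using that
    by (intro \<theta>_eq inv_into_into f_inv_into_f[of _ ?\<rho> L]) auto
  have "f \<in> epi V U"
  proof -
    have "f (?\<rho> g \<otimes>\<^bsub>V\<^esub> ?\<rho> h) = f (?\<rho> g) \<otimes>\<^bsub>U\<^esub> f (?\<rho> h)" if "g \<in> L" "h \<in> L" for g h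
    proof -
      have "?\<rho> g \<otimes>\<^bsub>V\<^esub> ?\<rho> h = ?\<rho> (g \<otimes>\<^bsub>F\<^esub> h)"
        using \<rho>_mult that by (simp add: V_def transition_monoid_def)
      then show ?thesis
        using that f subgroup.m_closed[OF L] \<theta>.hom_mult[of g h] by simp
    qed
    moreover have "f (?\<rho> g) \<in> carrier U" if "g \<in> L" for g
      using f[OF that] \<theta>.hom_closed[of g] that by simp
    moreover have "f ` carrier V = carrier U"
      using \<theta> f by (simp add: V_def image_image epi_def)
    ultimately show ?thesis
      by (auto simp: epi_def hom_def V_def)
  qed
  then show ?thesis
    using overline_class_epi[OF H, of "?\<rho> ` L" "?\<rho> \<one>\<^bsub>F\<^esub>" f U] V \<rho>_M U(1)
    unfolding V_def by blast
qed

text \<open>Minimality is arranged by passing to a conjugate of \<open>L\<close>, which induces the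
  same group on a translate of \<open>Y\<close>. No conjugate of a trivial \<open>L\<close> contains
  a cyclically reduced word, hence the case distinction.\<close>

lemma in_class_of_action:
  assumes H: "pseudovariety H" "transition_monoid A S \<in> overline_class H"
    and L: "subgroup L F" and U: "group U" "finite (carrier U)"
    and \<theta>: "\<theta> \<in> epi (F\<lparr>carrier := L\<rparr>) U"
    and Y: "Y \<subseteq> rcosets\<^bsub>F\<^esub> K"
    and fix_iff: "\<And>g. g \<in> L \<Longrightarrow> \<theta> g = \<one>\<^bsub>U\<^esub> \<longleftrightarrow> (\<forall>y\<in>Y. y #>\<^bsub>F\<^esub> g = y)"
  shows "in_class U H"
proof (cases "L = {\<one>\<^bsub>F\<^esub>}")
  case True
  have "\<theta> \<one>\<^bsub>F\<^esub> = \<one>\<^bsub>U\<^esub>"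
    using fix_iff[of "\<one>\<^bsub>F\<^esub>"] True Y coset_one by blast
  then have "carrier U = {\<one>\<^bsub>U\<^esub>}"
    using \<theta> True by (auto simp: epi_def)
  then show ?thesis
    by (rule overline_class_trivial[OF H U(1)])
next
  case False
  then obtain h where h: "h \<in> L" "h \<noteq> []"
    using subgroup.one_closed[OF L] one_F by auto
  have hF: "h \<in> carrier F"
    using h(1) subgroup.subset[OF L] by auto
  define conj where "conj c g = c \<otimes>\<^bsub>F\<^esub> g \<otimes>\<^bsub>F\<^esub> inv\<^bsub>F\<^esub> c" for c g
  have cancel: "c \<otimes>\<^bsub>F\<^esub> (inv\<^bsub>F\<^esub> c \<otimes>\<^bsub>F\<^esub> g) = g" "inv\<^bsub>F\<^esub> c \<otimes>\<^bsub>F\<^esub> (c \<otimes>\<^bsub>F\<^esub> g) = g"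
    if "c \<in> carrier F" "g \<in> carrier F" for c g
    using that by (simp_all flip: m_assoc)
  have conj_mult: "conj c (g \<otimes>\<^bsub>F\<^esub> g') = conj c g \<otimes>\<^bsub>F\<^esub> conj c g'"
    if "c \<in> carrier F" "g \<in> carrier F" "g' \<in> carrier F" for c g g'
    using that by (simp add: conj_def m_assoc cancel)
  have conj_inv: "conj c (inv\<^bsub>F\<^esub> g) = inv\<^bsub>F\<^esub> (conj c g)"
    if "c \<in> carrier F" "g \<in> carrier F" for c g
    using that by (simp add: conj_def m_assoc inv_mult_group)
  have conj_conj: "conj c (inv\<^bsub>F\<^esub> c \<otimes>\<^bsub>F\<^esub> g \<otimes>\<^bsub>F\<^esub> c) = g" if "c \<in> carrier F" "g \<in> carrier F" for c g
    using that by (simp add: conj_def m_assoc cancel)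
  \<comment> \<open>The candidates are the cyclically reduced \<open>e\<close> with
    \<open>c e c^-1\<close> in \<open>L\<close> for some \<open>c\<close>. The core of a nontrivial
    element of \<open>L\<close> is one; a candidate with the fewest periodic cosets is then
    chosen.\<close>
  define P where "P = (\<lambda>(c, e). c \<in> carrier F \<and> e \<in> carrier F \<and> cyc_reduced e \<and> conj c e \<in> L)"
  obtain s e0 where "h = s @ e0 @ winv s" "cyc_reduced e0"
    using cyc_reduced_conjugate[of h] h hF by (auto simp: carrier_F)
  moreover from this have "s \<in> carrier F" "e0 \<in> carrier F"
    using hF by (simp_all add: carrier_F reduced_append del: in_lists_conv_set)
  moreover from calculation have "conj s e0 = h"
    using hF mult_reduce[of "s @ e0" "winv s"]
    by (simp add: conj_def mult_F inv_F carrier_F reduce_reduced)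
  ultimately have "P (s, e0)"
    using h(1) by (simp add: P_def)
  then obtain ce where ce: "P ce" "\<And>x. P x \<Longrightarrow> card (per (snd ce)) \<le> card (per (snd x))"
    using ex_has_least_nat[of P "(s, e0)" "\<lambda>x. card (per (snd x))"] by blast
  obtain c e where [simp]: "ce = (c, e)" by (cases ce)
  have c: "c \<in> carrier F" and e: "e \<in> carrier F" "cyc_reduced e" "conj c e \<in> L"
    using ce(1) by (auto simp: P_def)
  \<comment> \<open>This is \<open>c^-1 L c\<close>, which acts on the translates \<open>y c\<close>
    as \<open>L\<close> acts on the cosets \<open>y\<close>.\<close>
  define L' where "L' = {g \<in> carrier F. conj c g \<in> L}"
  have L': "subgroup L' F"
  proof (rule subgroupI)
    have "conj c \<one>\<^bsub>F\<^esub> = \<one>\<^bsub>F\<^esub>"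
      using c by (simp add: conj_def)
    then show "L' \<noteq> {}"
      using subgroup.one_closed[OF L] by (auto simp: L'_def)
  qed (use c in \<open>auto simp: L'_def conj_mult conj_inv
      intro: subgroup.m_closed[OF L] subgroup.m_inv_closed[OF L]\<close>)
  have \<theta>': "(\<lambda>g. \<theta> (conj c g)) \<in> epi (F\<lparr>carrier := L'\<rparr>) U"
  proof -
    have "conj c ` L' = L"
    proof
      show "L \<subseteq> conj c ` L'"
      proof
        fix g assume "g \<in> L"
        then have "g = conj c (inv\<^bsub>F\<^esub> c \<otimes>\<^bsub>F\<^esub> g \<otimes>\<^bsub>F\<^esub> c)" "inv\<^bsub>F\<^esub> c \<otimes>\<^bsub>F\<^esub> g \<otimes>\<^bsub>F\<^esub> c \<in> L'"
          using c conj_conj subgroup.subset[OF L] by (auto simp: L'_def)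
        then show "g \<in> conj c ` L'"
          by (rule image_eqI)
      qed
    qed (auto simp: L'_def)
    then have "(\<lambda>g. \<theta> (conj c g)) ` L' = carrier U"
      using \<theta> by (simp add: epi_def image_comp[of \<theta> "conj c" L', unfolded comp_def, symmetric])
    then show ?thesis
      using \<theta> c by (auto simp: epi_def hom_def L'_def conj_mult)
  qed
  have fix_iff': "\<theta> (conj c g) = \<one>\<^bsub>U\<^esub> \<longleftrightarrow> (\<forall>y\<in>(\<lambda>y. y #>\<^bsub>F\<^esub> c) ` Y. y #>\<^bsub>F\<^esub> g = y)"
    if g: "g \<in> L'" for g
  proof -
    have "y #>\<^bsub>F\<^esub> conj c g = y \<longleftrightarrow> y #>\<^bsub>F\<^esub> c #>\<^bsub>F\<^esub> g = y #>\<^bsub>F\<^esub> c" if "y \<in> Y" for y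
    proof -
      have y: "y \<in> rcosets\<^bsub>F\<^esub> K" and gF: "g \<in> carrier F"
        using that Y g by (auto simp: L'_def)
      have "y #>\<^bsub>F\<^esub> conj c g = y \<longleftrightarrow> y #>\<^bsub>F\<^esub> (c \<otimes>\<^bsub>F\<^esub> g) = y #>\<^bsub>F\<^esub> c"
        unfolding conj_def using coset_mult_inv1[of y "c \<otimes>\<^bsub>F\<^esub> g" c] coset_mult_inv2[of y "c \<otimes>\<^bsub>F\<^esub> g" c]
          rcosets_subset[OF y] c gF by auto
      then show ?thesis
        using coset_assoc[OF y c gF] by simp
    qed
    then show ?thesis
      using fix_iff[of "conj c g"] g by (auto simp: L'_def)
  qed
  show ?thesis
  proof (rule in_class_of_minimal[OF H L' U \<theta>' _ fix_iff'])
    show "(\<lambda>y. y #>\<^bsub>F\<^esub> c) ` Y \<subseteq> rcosets\<^bsub>F\<^esub> K"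
      using Y c rcosets_closed by auto
    show "cyc_reduced e" "e \<in> L'"
      using e by (auto simp: L'_def)
    show "card (per e) \<le> card (per g)" if "g \<in> L'" "cyc_reduced g" for g
      using ce(2)[of "(c, g)"] that c by (simp add: P_def L'_def)
  qed
qed

text \<open>All members of \<open>U\<close> share the domain \<open>D\<close> of the identity
  \<open>i\<close>. \<open>X\<close> consists of the cosets of the vertices in \<open>D\<close>, and
  \<open>L\<close> of the group elements whose right multiplication agrees on them with some member
  of \<open>U\<close>; \<open>\<theta>\<close> picks that member.\<close>

lemma subgroup_action:
  assumes U: "U \<subseteq> carrier (transition_monoid A S)"
    and grp: "group (transition_monoid A S\<lparr>carrier := U, one := i\<rparr>)" (is "group ?U")
  obtains L \<theta> X where "subgroup L F" "X \<subseteq> rcosets\<^bsub>F\<^esub> K"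
    "\<theta> \<in> epi (F\<lparr>carrier := L\<rparr>) (transition_monoid A S\<lparr>carrier := U, one := i\<rparr>)"
    "\<And>g. g \<in> L \<Longrightarrow> \<theta> g = i \<longleftrightarrow> (\<forall>y\<in>X. y #>\<^bsub>F\<^esub> g = y)"
proof -
  interpret U: group ?U by (rule grp)
  have mult: "u \<otimes>\<^bsub>?U\<^esub> v = v \<circ>\<^sub>m u" for u v
    by (simp add: transition_monoid_def)
  have i: "i \<circ>\<^sub>m u = u" "u \<circ>\<^sub>m i = u" if "u \<in> U" for u
    using U.l_one[of u] U.r_one[of u] that unfolding mult by simp_all
  have iU: "i \<in> U"
    using U.one_closed by simp
  define D where "D = dom i"
  have dom: "dom u = D" if u: "u \<in> U" for u
  proof -
    obtain v where v: "v \<in> U" "v \<circ>\<^sub>m u = i"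
      using U.r_inv_ex[of u] u unfolding mult by auto
    have "dom u \<subseteq> D" if "u \<in> U" for u
      unfolding D_def by (subst i(2)[OF that, symmetric]) (auto simp: map_comp_Some_iff)
    moreover have "D \<subseteq> dom u"
      unfolding D_def v(2)[symmetric] by (auto simp: map_comp_Some_iff)
    ultimately show ?thesis
      using u by blast
  qed
  have ran: "q \<in> D" if "u \<in> U" "u p = Some q" for u p q
  proof -
    have "(i \<circ>\<^sub>m u) p = Some q"
      using i(1)[OF that(1)] that(2) by simp
    then show ?thesis
      using that(2) by (auto simp: D_def map_comp_Some_iff)
  qed
  have D_states: "p \<in> states S" if "p \<in> D" for p
    using that iU U path_states by (auto simp: D_def transition_monoid_def transition_eq)
  define R where "R g u \<longleftrightarrow> g \<in> carrier F \<and> u \<in> U \<and> (\<forall>p q. u p = Some q \<longrightarrow> co p #>\<^bsub>F\<^esub> g = co q)"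
    for g u
  have R_ex: "\<exists>g. R g u" if u: "u \<in> U" for u
  proof -
    obtain w where w: "w \<in> lists (letters A)" "u = transition S w"
      using u U by (auto simp: transition_monoid_def simp del: in_lists_conv_set)
    then have "R (reduce w) u"
      using u reduce_in_F[OF w(1)] co_path co_subset path_states
      unfolding R_def by (metis transition_eq)
    then show ?thesis
      by blast
  qed
  \<comment> \<open>A vertex is determined by its coset, so \<open>g\<close> leaves no choice on the
    common domain; this makes \<open>\<theta>\<close> well defined.\<close>
  have R_unique: "u = v" if uv: "R g u" "R g v" for g u v
  proof
    fix p
    show "u p = v p"
    proof (cases "p \<in> D")
      case True
      then obtain q r where qr: "u p = Some q" "v p = Some r"
        using uv dom[of u] dom[of v] unfolding R_def by blast
      then have "co q = co r" "q \<in> states S" "r \<in> states S"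
        using uv ran D_states unfolding R_def by metis+
      then show ?thesis
        using qr inj_onD[OF co_inj] by metis
    next
      case False
      then show ?thesis
        using uv dom[of u] dom[of v] unfolding R_def by (metis domIff)
    qed
  qed
  have R_mult: "R (g \<otimes>\<^bsub>F\<^esub> h) (u \<otimes>\<^bsub>?U\<^esub> v)" if gh: "R g u" "R h v" for g h u v
  proof -
    have "co p #>\<^bsub>F\<^esub> (g \<otimes>\<^bsub>F\<^esub> h) = co r" if vu: "(v \<circ>\<^sub>m u) p = Some r" for p r
    proof -
      obtain q where q: "u p = Some q" "v q = Some r"
        using vu by (auto simp: map_comp_Some_iff)
      then have "p \<in> states S"
        using gh(1) dom[of u] D_states unfolding R_def by blast
      then show ?thesis
        using q gh coset_mult_assoc[of "co p" g h] co_subset unfolding R_def by metis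
    qed
    moreover have "u \<otimes>\<^bsub>?U\<^esub> v \<in> U"
      using U.m_closed[of u v] gh by (simp add: R_def)
    ultimately show ?thesis
      using gh unfolding R_def mult by auto
  qed
  \<comment> \<open>By idempotence \<open>i\<close> sends both \<open>p\<close> and its image
    \<open>q\<close> to \<open>q\<close>. A group element \<open>h\<close> acting as
    \<open>i\<close> therefore maps their cosets to the same coset, and \<open>h\<close> can be
    cancelled.\<close>
  have i_id: "p = q" if ip: "i p = Some q" for p q
  proof -
    obtain h where h: "R h i"
      using R_ex iU by blast
    have pq: "p \<in> states S" "q \<in> states S"
      using ran[OF iU ip] ip D_states by (auto simp: D_def)
    have "(i \<circ>\<^sub>m i) p = i p"
      using i(1)[OF iU] by simp
    then have "i q = Some q"
      using ip by simp
    then have "co p #>\<^bsub>F\<^esub> h = co q #>\<^bsub>F\<^esub> h"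
      using ip h unfolding R_def by metis
    then have "co p #>\<^bsub>F\<^esub> h #>\<^bsub>F\<^esub> inv\<^bsub>F\<^esub> h = co q #>\<^bsub>F\<^esub> h #>\<^bsub>F\<^esub> inv\<^bsub>F\<^esub> h"
      by simp
    then have "co p = co q"
      using h co_rcosets pq by (simp add: R_def coset_assoc coset_one)
    then show "p = q"
      using inj_onD[OF co_inj] pq by blast
  qed
  have R_inv: "R (inv\<^bsub>F\<^esub> g) (inv\<^bsub>?U\<^esub> u)" if R: "R g u" for g u
  proof -
    define v where "v = inv\<^bsub>?U\<^esub> u"
    have uU: "u \<in> carrier ?U"
      using R by (simp add: R_def)
    have vU: "v \<in> U"
      using U.inv_closed[OF uU] by (simp add: v_def)
    have uv: "u \<circ>\<^sub>m v = i"
      using U.l_inv[OF uU] unfolding mult v_def by simp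
    have "co p #>\<^bsub>F\<^esub> inv\<^bsub>F\<^esub> g = co q" if "v p = Some q" for p q
    proof -
      have "q \<in> D"
        using ran[OF vU that] .
      then obtain r where r: "u q = Some r"
        using dom[of u] uU by auto
      then have "i p = Some r"
        using that uv by (metis map_comp_simps(2))
      then have "u q = Some p"
        using i_id r by blast
      then have "co p = co q #>\<^bsub>F\<^esub> g" "g \<in> carrier F"
        using R unfolding R_def by auto
      then show ?thesis
        using co_rcosets[OF D_states[OF \<open>q \<in> D\<close>]] by (simp add: coset_assoc coset_one)
    qed
    then show ?thesis
      using R vU unfolding R_def v_def by simp
  qed
  define L where "L = {g. \<exists>u. R g u}"
  define \<theta> where "\<theta> g = (THE u. R g u)" for g
  have \<theta>_eq: "\<theta> g = u" if "R g u" for g u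
    unfolding \<theta>_def using that R_unique by blast
  have \<theta>_R: "R g (\<theta> g)" if "g \<in> L" for g
    using that \<theta>_eq by (auto simp: L_def)
  have L: "subgroup L F"
  proof (rule subgroupI)
    show "L \<subseteq> carrier F"
      by (auto simp: L_def R_def)
    show "L \<noteq> {}"
      using R_ex[OF iU] by (auto simp: L_def)
  qed (use R_inv R_mult in \<open>unfold L_def, blast+\<close>)
  have "\<theta> \<in> epi (F\<lparr>carrier := L\<rparr>) ?U"
  proof -
    have "\<theta> g \<in> U" if "g \<in> L" for g
      using \<theta>_R[OF that] by (simp add: R_def)
    moreover have "\<theta> (g \<otimes>\<^bsub>F\<^esub> h) = \<theta> g \<otimes>\<^bsub>?U\<^esub> \<theta> h" if "g \<in> L" "h \<in> L" for g h
      using R_mult[OF \<theta>_R[OF that(1)] \<theta>_R[OF that(2)]] by (rule \<theta>_eq)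
    moreover have "u \<in> \<theta> ` L" if "u \<in> U" for u
      using R_ex[OF that] \<theta>_eq by (force simp: L_def)
    ultimately show ?thesis
      by (auto simp: epi_def hom_def)
  qed
  moreover have "\<theta> g = \<one>\<^bsub>?U\<^esub> \<longleftrightarrow> (\<forall>y\<in>co ` D. y #>\<^bsub>F\<^esub> g = y)" if g: "g \<in> L" for g
  proof
    assume "\<theta> g = \<one>\<^bsub>?U\<^esub>"
    then have "R g i"
      using \<theta>_R[OF g] by simp
    then show "\<forall>y\<in>co ` D. y #>\<^bsub>F\<^esub> g = y"
      using i_id unfolding R_def D_def by blast
  next
    assume "\<forall>y\<in>co ` D. y #>\<^bsub>F\<^esub> g = y"
    then have "R g i"
      using i_id \<theta>_R[OF g] iU unfolding R_def D_def by blast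
    then show "\<theta> g = \<one>\<^bsub>?U\<^esub>"
      using \<theta>_eq by simp
  qed
  moreover have "co ` D \<subseteq> rcosets\<^bsub>F\<^esub> K"
    using co_rcosets D_states by auto
  ultimately show thesis
    using L that by simp
qed

end


section \<open>Transfer along the automorphism\<close>

theorem theorem5p5:
  fixes A :: "'a set" and H :: "nat monoid set"
  assumes "finite A"
    and "pseudovariety H"
    and "\<phi> \<in> iso (free_group A) (free_group A)"
    and "subgroup K (free_group A)"
    and "finitely_generated (free_group A) K"
    and "stallings_automaton A K S"
    and "stallings_automaton A (\<phi> ` K) S'"
    and "transition_monoid A S \<in> overline_class H"
  shows "transition_monoid A S' \<in> overline_class H"
proof -
  obtain T co where S: "stallings A T S co" and K: "K = generate (free_group A) T"
    using stallings_automaton_cosets[OF assms(6)] .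
  obtain T' co' where S': "stallings A T' S' co'" and K': "\<phi> ` K = generate (free_group A) T'"
    using stallings_automaton_cosets[OF assms(7)] .
  interpret S: stallings A T S co by (rule S)
  interpret S': stallings A T' S' co' by (rule S')
  let ?F = "free_group A" and ?M = "transition_monoid A S'"
  have \<phi>: "\<phi> \<in> hom ?F ?F" "\<phi> ` carrier ?F = carrier ?F" "inj_on \<phi> (carrier ?F)"
    using assms(3) by (auto simp: iso_iff)
  interpret \<phi>: group_hom ?F ?F \<phi>
    by unfold_locales (rule \<phi>(1))
  have \<phi>_coset: "\<phi> ` (M #>\<^bsub>?F\<^esub> g) = \<phi> ` M #>\<^bsub>?F\<^esub> \<phi> g" if "M \<subseteq> carrier ?F" "g \<in> carrier ?F" for M g
  proof -
    have coset: "M #>\<^bsub>?F\<^esub> g = (\<lambda>h. h \<otimes>\<^bsub>?F\<^esub> g) ` M" for M g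
      by (auto simp: r_coset_def)
    show ?thesis
      unfolding coset image_image 
      by (intro image_cong refl \<phi>.hom_mult) (use that in blast)+
  qed
  have "in_class (?M\<lparr>carrier := U, one := i\<rparr>) H"
    if U: "U \<subseteq> carrier ?M" and grp: "group (?M\<lparr>carrier := U, one := i\<rparr>)" for U i
  proof -
    obtain L \<theta> X where L: "subgroup L ?F" and X: "X \<subseteq> rcosets\<^bsub>?F\<^esub> (\<phi> ` K)"
      and \<theta>: "\<theta> \<in> epi (?F\<lparr>carrier := L\<rparr>) (?M\<lparr>carrier := U, one := i\<rparr>)"
      and fix_iff: "\<And>g. g \<in> L \<Longrightarrow> \<theta> g = i \<longleftrightarrow> (\<forall>y\<in>X. y #>\<^bsub>?F\<^esub> g = y)"
      by (rule S'.subgroup_action[OF U grp, folded K']) (rule that)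
    \<comment> \<open>\<open>L'\<close> and \<open>Y\<close> are pulled back along
      \<open>\<phi>\<close>. As \<open>\<phi>\<close> is bijective and maps the cosets of
      \<open>K\<close> onto those of its image, compatibly with right multiplication,
      \<open>L'\<close> induces on \<open>Y\<close> the group that \<open>L\<close> induces on
      \<open>X\<close>.\<close>
    define L' where "L' = {g \<in> carrier ?F. \<phi> g \<in> L}"
    define Y where "Y = {y \<in> rcosets\<^bsub>?F\<^esub> K. \<phi> ` y \<in> X}"
    have L': "subgroup L' ?F"
    proof (rule S.subgroupI)
      show "L' \<noteq> {}"
        using subgroup.one_closed[OF L] S.one_closed by (auto simp: L'_def)
    qed (auto simp: L'_def intro: subgroup.m_closed[OF L] subgroup.m_inv_closed[OF L])
    have "\<phi> ` L' = L"
      using subgroup.subset[OF L] \<phi>(2) by (fastforce simp: L'_def)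
    then have "(\<theta> \<circ> \<phi>) ` L' = U"
      using \<theta> image_comp[of \<theta> \<phi> L'] by (simp add: epi_def)
    then have \<theta>': "\<theta> \<circ> \<phi> \<in> epi (?F\<lparr>carrier := L'\<rparr>) (?M\<lparr>carrier := U, one := i\<rparr>)"
      using \<theta> by (auto simp: epi_def hom_def L'_def)
    have "(\<forall>x\<in>X. x #>\<^bsub>?F\<^esub> \<phi> g = x) \<longleftrightarrow> (\<forall>y\<in>Y. y #>\<^bsub>?F\<^esub> g = y)" if g: "g \<in> carrier ?F" for g
    proof -
      have "\<phi> ` y #>\<^bsub>?F\<^esub> \<phi> g = \<phi> ` y \<longleftrightarrow> y #>\<^bsub>?F\<^esub> g = y" if "y \<in> Y" for y
      proof -
        have y: "y \<subseteq> carrier ?F"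
          using that S.rcosets_subset unfolding Y_def K by blast
        then show ?thesis
          using \<phi>_coset[OF y g] inj_on_image_eq_iff[OF \<phi>(3) S.r_coset_subset_G[OF y g] y] by simp
      qed
      moreover have "X = image \<phi> ` Y"
      proof
        show "X \<subseteq> image \<phi> ` Y"
        proof
          fix x assume x: "x \<in> X"
          then obtain v where v: "v \<in> carrier ?F" "x = \<phi> ` K #>\<^bsub>?F\<^esub> v"
            using X by (auto simp: RCOSETS_def)
          moreover obtain w where w: "w \<in> carrier ?F" "v = \<phi> w"
            using v(1) \<phi>(2) by (metis imageE)
          ultimately have "x = \<phi> ` (K #>\<^bsub>?F\<^esub> w)"
            using \<phi>_coset S.K_subset unfolding K by simp
          moreover from this have "K #>\<^bsub>?F\<^esub> w \<in> Y"
            using x w(1) S.rcosetsI[OF S.K_subset] by (simp add: Y_def K)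
          ultimately show "x \<in> image \<phi> ` Y"
            by blast
        qed
      qed (auto simp: Y_def)
      ultimately show ?thesis
        by simp
    qed
    then have fix_iff': "(\<theta> \<circ> \<phi>) g = \<one>\<^bsub>?M\<lparr>carrier := U, one := i\<rparr>\<^esub> \<longleftrightarrow> (\<forall>y\<in>Y. y #>\<^bsub>?F\<^esub> g = y)"
      if "g \<in> L'" for g
      using that fix_iff[of "\<phi> g"] by (simp add: L'_def)
    have fin: "finite (carrier (?M\<lparr>carrier := U, one := i\<rparr>))"
      using finite_subset[OF U S'.finite_transition_monoid] by simp
    have "Y \<subseteq> rcosets\<^bsub>?F\<^esub> (generate ?F T)"
      by (auto simp: Y_def K)
    then show ?thesis
      using S.in_class_of_action[OF assms(2,8) L' grp fin \<theta>' _ fix_iff'] by simp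
  qed
  then show ?thesis
    using S'.transition_monoid S'.finite_transition_monoid by (simp add: overline_class_def)
qed

end
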